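(* Let $G$ be a finite abelian group of order $n$ with distinct characters $\chi_1,\dots,\chi_n$ ($\chi_1$ principal), and let $\Gamma=\mathrm{BiCay}(G;R,L,T)$ be an integral bi-Cayley graph. Let $\lambda_1,\dots,\lambda_{2n}$ be as in the context, $H=\{k\mid\chi_k(T)=0,1\le k\le n\}$, $M_0=\gcd(\lambda_{2k}-\lambda_{2k-1}\mid k\notin H)$, $M_1=\gcd(\lambda_2-\lambda_{2k-1}\mid k\notin H)$, and for $X\in\{R,L\}$, $M_X=\gcd(\lambda_2-\chi_k(X)\mid k\in H)$ and $M_{\emptyset,X}=\gcd(|X|-\chi_k(X)\mid 1\le k\le n)$. For a vertex $(g_p)_i$ with $i\in\{0,1\}$, put $X=R$ if $i=0$ and $X=L$ if $i=1$. Then $\Gamma$ is periodic at the vertex $(g_p)_i$ at time $t$ if and only if $t\in\{\frac{2\pi z}{M_{\emptyset,X}}\mid z\in\mathbb{Z}\setminus\{0\}\}$ when $T=\emptyset$, and $t\in\{\frac{2\pi z}{\gcd(M_0,M_1,M_X)}\mid z\in\mathbb{Z}\setminus\{0\}\}$ when $T\neq\emptyset$. Furthermore, an arbitrary bi-Cayley graph $\Gamma=\mathrm{BiCay}(G;R,L,T)$ over a finite abelian group $G$ is periodic at time $t$ if and only if $\Gamma$ is integral and $t\in\{\frac{2\pi z}{\gcd(M_{\emptyset,R},M_{\emptyset,L})}\mid z\in\mathbb{Z}\setminus\{0\}\}$ when $T=\emptyset$, and $t\in\{\frac{2\pi z}{\gcd(M_0,M_1,M_R,M_L)}\mid z\in\mathbb{Z}\setminus\{0\}\}$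 when $T\neq\emptyset$.
   Context: For $S\subseteq G$ and a character $\chi$, $\chi(S)=\sum_{s\in S}\chi(s)$, $\chi(\emptyset)=0$. Given $R,L,T\subseteq G$ with $R=R^{-1}$, $L=L^{-1}$, identity not in $R\cup L$, $\mathrm{BiCay}(G;R,L,T)$ has vertex set $G_0\cup G_1$, $G_i=\{g_i\mid g\in G\}$ disjoint copies of $G$, and edges $\{h_0,g_0\}$ when $gh^{-1}\in R$, $\{h_1,g_1\}$ when $gh^{-1}\in L$, $\{h_0,g_1\}$ when $gh^{-1}\in T$. For $1\le k\le n$, $\lambda_{2k-1}=\frac{\chi_k(R)+\chi_k(L)-\sqrt{(\chi_k(R)-\chi_k(L))^2+4|\chi_k(T)|^2}}{2}$, $\lambda_{2k}=\frac{\chi_k(R)+\chi_k(L)+\sqrt{(\chi_k(R)-\chi_k(L))^2+4|\chi_k(T)|^2}}{2}$. With $H(t)=\exp(-\mathrm{i}tD)$ for the adjacency matrix $D$, $\Gamma$ is periodic at vertex $u$ at time $t\neq0$ if $|H_{u,u}(t)|=1$, and periodic at time $t\neq0$ if $|H_{u,u}(t)|=1$ for every vertex $u$. Integral: all adjacency eigenvalues are integers. Gcd of nonnegative integers with $\gcd(a,0)=a$.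
   Formalization: When the gcd M is 0 (only if T is empty and X, or both R and L in the second part, are empty), the set {2πz/M} is undefined; it is read as the set of all nonzero t. *)

theory Defs
  imports "HOL-Analysis.Analysis"
begin

text \<open>
  A finite abelian group is a type of class \<open>{finite, ab_group_add}\<close>, written additively:
  \<open>g h\<^sup>-\<^sup>1\<close> is \<open>g - h\<close>. A simple graph on a finite vertex type is given by its set of edges,
  each edge being the set of its two ends.
\<close>

definition characters :: "('a::ab_group_add \<Rightarrow> complex) set" where
  "characters = {\<psi>. (\<forall>x y. \<psi> (x + y) = \<psi> x * \<psi> y) \<and> (\<forall>x. \<psi> x \<noteq> 0)}"

definition char_sum :: "('a \<Rightarrow> complex) \<Rightarrow> 'a set \<Rightarrow> complex" where
  "char_sum \<psi> S = (\<Sum>s\<in>S. \<psi> s)"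

definition adj_mat :: "'v set set \<Rightarrow> complex ^ 'v ^ 'v::finite" where
  "adj_mat E = (\<chi> u v. if {u, v} \<in> E then 1 else 0)"

definition mat_pow :: "complex ^ 'v ^ 'v::finite \<Rightarrow> nat \<Rightarrow> complex ^ 'v ^ 'v" where
  "mat_pow A m = (((**) A) ^^ m) (mat 1)"

text \<open>The constant \<open>exp\<close> of the library is not available here: multiplication on the type of
  square matrices is componentwise.\<close>

definition mat_exp :: "complex ^ 'v ^ 'v::finite \<Rightarrow> complex ^ 'v ^ 'v" where
  "mat_exp A = (\<Sum>m. (1 / fact m) *\<^sub>R mat_pow A m)"

definition transition_mat :: "'v set set \<Rightarrow> real \<Rightarrow> complex ^ 'v ^ 'v::finite" where
  "transition_mat E t = mat_exp (\<chi> u v. - \<i> * of_real t * adj_mat E $ u $ v)"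

definition periodic_at :: "'v::finite set set \<Rightarrow> 'v \<Rightarrow> real \<Rightarrow> bool" where
  "periodic_at E u t \<longleftrightarrow> t \<noteq> 0 \<and> cmod (transition_mat E t $ u $ u) = 1"

definition periodic :: "'v::finite set set \<Rightarrow> real \<Rightarrow> bool" where
  "periodic E t \<longleftrightarrow> t \<noteq> 0 \<and> (\<forall>u. cmod (transition_mat E t $ u $ u) = 1)"

definition mat_eigenvalue :: "complex ^ 'v ^ 'v::finite \<Rightarrow> complex \<Rightarrow> bool" where
  "mat_eigenvalue A c \<longleftrightarrow> (\<exists>v. v \<noteq> 0 \<and> A *v v = c *s v)"

definition integral_graph :: "'v::finite set set \<Rightarrow> bool" where
  "integral_graph E \<longleftrightarrow> (\<forall>c. mat_eigenvalue (adj_mat E) c \<longrightarrow> c \<in> \<int>)"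

text \<open>\<open>Inl g\<close> is the vertex \<open>g\<^sub>0\<close> and \<open>Inr g\<close> is the vertex \<open>g\<^sub>1\<close>.\<close>

definition BiCay :: "'a::ab_group_add set \<Rightarrow> 'a set \<Rightarrow> 'a set \<Rightarrow> ('a + 'a) set set" where
  "BiCay R L T =
     {{Inl h, Inl g} | h g. g - h \<in> R} \<union>
     {{Inr h, Inr g} | h g. g - h \<in> L} \<union>
     {{Inl h, Inr g} | h g. g - h \<in> T}"

text \<open>The sum of a character over an inverse-closed set is real, so that \<open>Re\<close> loses nothing in
  the formulas below.\<close>

lemma norm_character:
  fixes \<psi> :: "'a::{finite, ab_group_add} \<Rightarrow> complex"
  assumes "\<psi> \<in> characters"
  shows "cmod (\<psi> x) = 1"
proof -
  have mult: "\<psi> (x + y) = \<psi> x * \<psi> y" and nz: "\<psi> x \<noteq> 0" for x y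
    using assms by (auto simp: characters_def)
  have "Max (range (\<lambda>x. cmod (\<psi> x))) \<in> range (\<lambda>x. cmod (\<psi> x))"
    by (intro Max_in) auto
  then obtain m where m: "Max (range (\<lambda>x. cmod (\<psi> x))) = cmod (\<psi> m)"
    by (elim rangeE)
  have max: "cmod (\<psi> y) \<le> cmod (\<psi> m)" for y
    unfolding m [symmetric] by (intro Max_ge) auto
  have le1: "cmod (\<psi> y) \<le> 1" for y
    using max [of "m + y"] nz [of m] by (simp add: mult norm_mult)
  have "\<psi> 0 = 1"
    using mult [of 0 0] nz [of 0] by simp
  then have "cmod (\<psi> x) * cmod (\<psi> (- x)) = 1"
    using mult [of x "- x"] by (simp flip: norm_mult)
  then show ?thesis
    using le1 [of x] le1 [of "- x"] mult_left_le [of "cmod (\<psi> (- x))" "cmod (\<psi> x)"] by simp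
qed

lemma char_sum_in_Reals:
  fixes \<psi> :: "'a::{finite, ab_group_add} \<Rightarrow> complex"
  assumes "\<psi> \<in> characters" and "uminus ` S = S"
  shows "char_sum \<psi> S \<in> \<real>"
proof -
  have mult: "\<psi> (x + y) = \<psi> x * \<psi> y" and nz: "\<psi> x \<noteq> 0" for x y
    using assms by (auto simp: characters_def)
  have "\<psi> 0 = 1"
    using mult [of 0 0] nz [of 0] by simp
  then have "\<psi> x * \<psi> (- x) = 1" for x
    using mult [of x "- x"] by simp
  moreover have "\<psi> x * cnj (\<psi> x) = 1" for x
    using norm_character [OF assms(1), of x] by (simp add: complex_norm_square [symmetric])
  ultimately have "\<psi> (- x) = cnj (\<psi> x)" for x
    using nz [of x] by (metis mult_left_cancel)
  then have "cnj (char_sum \<psi> S) = (\<Sum>x\<in>S. \<psi> (- x))"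
    by (simp add: char_sum_def)
  also have "\<dots> = (\<Sum>x\<in>uminus ` S. \<psi> x)"
    by (simp add: sum.reindex)
  finally show ?thesis
    using assms(2) by (simp add: char_sum_def Reals_cnj_iff)
qed

text \<open>In the following, \<open>\<psi> 1, \<dots>, \<psi> n\<close> with \<open>n = CARD('a)\<close> are the characters of the group, and
  \<open>lam \<psi> R L T j\<close> is \<open>\<lambda>\<^sub>j\<close>; both \<open>j = 2 * k - 1\<close> and \<open>j = 2 * k\<close> satisfy \<open>(j + 1) div 2 = k\<close>.\<close>

definition lam :: "(nat \<Rightarrow> 'a \<Rightarrow> complex) \<Rightarrow> 'a set \<Rightarrow> 'a set \<Rightarrow> 'a set \<Rightarrow> nat \<Rightarrow> real" where
  "lam \<psi> R L T j =
     (let k = (j + 1) div 2;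
          r = Re (char_sum (\<psi> k) R);
          l = Re (char_sum (\<psi> k) L);
          s = sqrt ((r - l)\<^sup>2 + 4 * (cmod (char_sum (\<psi> k) T))\<^sup>2)
      in if even j then (r + l + s) / 2 else (r + l - s) / 2)"

definition Hset :: "(nat \<Rightarrow> 'a::finite \<Rightarrow> complex) \<Rightarrow> 'a set \<Rightarrow> nat set" where
  "Hset \<psi> T = {k \<in> {1..CARD('a)}. char_sum (\<psi> k) T = 0}"

text \<open>The gcd of a set of real numbers all of which are integers, with value \<open>0\<close> for the empty set.\<close>

definition gcd_set :: "real set \<Rightarrow> int" where
  "gcd_set S = Gcd {m. real_of_int m \<in> S}"

definition M0 :: "(nat \<Rightarrow> 'a::finite \<Rightarrow> complex) \<Rightarrow> 'a set \<Rightarrow> 'a set \<Rightarrow> 'a set \<Rightarrow> int" where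
  "M0 \<psi> R L T =
     gcd_set ((\<lambda>k. lam \<psi> R L T (2 * k) - lam \<psi> R L T (2 * k - 1)) ` ({1..CARD('a)} - Hset \<psi> T))"

definition M1 :: "(nat \<Rightarrow> 'a::finite \<Rightarrow> complex) \<Rightarrow> 'a set \<Rightarrow> 'a set \<Rightarrow> 'a set \<Rightarrow> int" where
  "M1 \<psi> R L T =
     gcd_set ((\<lambda>k. lam \<psi> R L T 2 - lam \<psi> R L T (2 * k - 1)) ` ({1..CARD('a)} - Hset \<psi> T))"

definition MX :: "(nat \<Rightarrow> 'a::finite \<Rightarrow> complex) \<Rightarrow> 'a set \<Rightarrow> 'a set \<Rightarrow> 'a set \<Rightarrow> 'a set \<Rightarrow> int" where
  "MX \<psi> R L T X =
     gcd_set ((\<lambda>k. lam \<psi> R L T 2 - Re (char_sum (\<psi> k) X)) ` Hset \<psi> T)"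

definition Mempty :: "(nat \<Rightarrow> 'a::finite \<Rightarrow> complex) \<Rightarrow> 'a set \<Rightarrow> int" where
  "Mempty \<psi> X = gcd_set ((\<lambda>k. real (card X) - Re (char_sum (\<psi> k) X)) ` {1..CARD('a)})"

text \<open>
  The set of all \<open>2 \<pi> z / M\<close> with \<open>z\<close> a nonzero integer. These are the \<open>t \<noteq> 0\<close> with
  \<open>t M \<in> 2 \<pi> \<int>\<close>, and for \<open>M = 0\<close>, where the quotient is undefined, the set is read in this way.
  For a bi-Cayley graph that case arises only when \<open>T\<close> and the sets \<open>X\<close> entering the gcd are empty,
  that is, for isolated vertices.
\<close>

definition period_times :: "int \<Rightarrow> real set" where
  "period_times M =
     (if M = 0 then {t. t \<noteq> 0} else {2 * pi * of_int z / of_int M | z :: int. z \<noteq> 0})"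

end

theory Submission
  imports Defs
begin

text \<open>
  On the functions \<open>a \<chi>\<close> on \<open>G\<^sub>0\<close> and \<open>b \<chi>\<close> on \<open>G\<^sub>1\<close>, for a fixed character \<open>\<chi>\<close>, the adjacency
  matrix acts as the Hermitian matrix with diagonal \<open>\<chi>(R), \<chi>(L)\<close> and off-diagonal entry \<open>\<chi>(T)\<close>.
  Hence \<open>H\<^sub>u\<^sub>u(t)\<close> is a convex combination of the unit numbers \<open>exp (- \<i> t \<theta>)\<close> with \<open>\<theta>\<close> in a set of
  eigenvalues that depends only on the copy of \<open>G\<close> containing \<open>u\<close>, all weights being positive. It has
  modulus \<open>1\<close> if and only if \<open>t\<close> times any difference of these eigenvalues lies in \<open>2 \<pi> \<int>\<close>; for
  integral graphs this is a statement about a gcd.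

  If the graph is periodic, the vanishing of the trace makes all eigenvalues rational multiples of
  \<open>2 \<pi> / t\<close>. As \<open>\<lambda>\<^sub>1 + \<lambda>\<^sub>2 = |R| + |L|\<close>, and \<open>\<lambda>\<^sub>2 = |T|\<close> when \<open>R\<close> and \<open>L\<close> are empty, one of these
  multiples is a nonzero rational number. Therefore all eigenvalues are rational, hence integers.
  When \<open>T\<close> is empty, the argument applies to the two Cayley graphs separately.
\<close>

lemma character_add: "\<phi> \<in> characters \<Longrightarrow> \<phi> (x + y) = \<phi> x * \<phi> y"
  by (simp add: characters_def)

lemma character_nonzero: "\<phi> \<in> characters \<Longrightarrow> \<phi> x \<noteq> 0"
  by (simp add: characters_def)

lemma character_zero: "\<phi> \<in> characters \<Longrightarrow> \<phi> 0 = 1"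
  using character_add [of \<phi> 0 0] character_nonzero [of \<phi> 0] by simp

lemma character_uminus:
  fixes \<phi> :: "'a::{finite, ab_group_add} \<Rightarrow> complex"
  assumes "\<phi> \<in> characters"
  shows "\<phi> (- x) = cnj (\<phi> x)"
proof -
  have "\<phi> x * \<phi> (- x) = 1"
    using character_add [OF assms, of x "- x"] character_zero [OF assms] by simp
  moreover have "\<phi> x * cnj (\<phi> x) = 1"
    using norm_character [OF assms, of x] by (simp add: complex_norm_square [symmetric])
  ultimately show ?thesis
    using character_nonzero [OF assms, of x] by (metis mult_left_cancel)
qed

lemma character_mult_cnj:
  fixes \<phi> :: "'a::{finite, ab_group_add} \<Rightarrow> complex"
  assumes "\<phi> \<in> characters"
  shows "\<phi> x * cnj (\<phi> x) = 1"
  using norm_character [OF assms, of x] by (simp add: complex_norm_square [symmetric])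

lemma cnj_character: "\<phi> \<in> characters \<Longrightarrow> (\<lambda>x. cnj (\<phi> x)) \<in> characters"
  by (simp add: characters_def)

lemma character_orthogonality:
  fixes \<phi> \<eta> :: "'a::{finite, ab_group_add} \<Rightarrow> complex"
  assumes "\<phi> \<in> characters" "\<eta> \<in> characters"
  shows "(\<Sum>x\<in>UNIV. \<phi> x * cnj (\<eta> x)) = (if \<phi> = \<eta> then of_nat CARD('a) else 0)"
proof (cases "\<phi> = \<eta>")
  case True
  then show ?thesis
    using character_mult_cnj [OF assms(2)] by simp
next
  case False
  then obtain y where y: "\<phi> y \<noteq> \<eta> y"
    by blast
  let ?S = "\<Sum>x\<in>UNIV. \<phi> x * cnj (\<eta> x)"
  have "?S = (\<Sum>x\<in>UNIV. \<phi> (x + y) * cnj (\<eta> (x + y)))"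
    by (rule sum.reindex_bij_witness [of _ "\<lambda>x. x + y" "\<lambda>x. x - y"]) auto
  also have "\<dots> = \<phi> y * cnj (\<eta> y) * ?S"
    by (simp add: sum_distrib_left character_add assms mult_ac)
  finally have "?S = 0 \<or> \<phi> y * cnj (\<eta> y) = 1"
    by simp
  moreover have "\<phi> y * cnj (\<eta> y) \<noteq> 1"
    using character_mult_cnj [OF assms(2), of y] y by (metis character_nonzero [OF assms(2)]
        complex_cnj_zero_iff mult_right_cancel)
  ultimately show ?thesis
    using False by simp
qed

text \<open>The square matrix of character values has its conjugate transpose, divided by the order of
  the group, as a right inverse, hence also as a left inverse.\<close>

lemma character_orthogonality_dual:
  fixes \<psi> :: "nat \<Rightarrow> 'a::{finite, ab_group_add} \<Rightarrow> complex"
  assumes "bij_betw \<psi> {1..CARD('a)} characters"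
  shows "(\<Sum>k=1..CARD('a). cnj (\<psi> k x) * \<psi> k y) = (if x = y then of_nat CARD('a) else 0)"
proof -
  obtain e :: "'a \<Rightarrow> nat" where e: "bij_betw e UNIV {1..CARD('a)}"
    using finite_same_card_bij [of "UNIV :: 'a set" "{1..CARD('a)}"] by auto
  then have f: "bij_betw (\<psi> \<circ> e) UNIV characters"
    using assms by (rule bij_betw_trans)
  then have char: "\<psi> (e a) \<in> characters" for a
    by (auto simp: bij_betw_def)
  have inj: "\<psi> (e a) = \<psi> (e b) \<longleftrightarrow> a = b" for a b
    using f by (auto simp: bij_betw_def inj_on_def)
  define M :: "((complex, 'a) vec, 'a) vec" where "M = (\<chi> a x. \<psi> (e a) x)"
  define N :: "((complex, 'a) vec, 'a) vec" where "N = (\<chi> x a. cnj (\<psi> (e a) x) / of_nat CARD('a))"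
  have "M ** N = mat 1"
    by (simp add: vec_eq_iff M_def N_def matrix_matrix_mult_def mat_def
        sum_divide_distrib [symmetric] character_orthogonality char inj)
  then have "N ** M = mat 1"
    by (simp add: matrix_left_right_inverse)
  then have "(N ** M) $ x $ y = (if x = y then 1 else 0)"
    by (simp add: mat_def)
  then have "(\<Sum>a\<in>UNIV. cnj (\<psi> (e a) x) * \<psi> (e a) y) = (if x = y then of_nat CARD('a) else 0)"
    by (simp add: M_def N_def matrix_matrix_mult_def sum_divide_distrib [symmetric]
        split: if_splits)
  then show ?thesis
    using sum.reindex_bij_betw [OF e, of "\<lambda>k. cnj (\<psi> k x) * \<psi> k y"] by simp
qed

lemma sum_UNIV_Plus:
  fixes f :: "'a::finite + 'b::finite \<Rightarrow> 'c::comm_monoid_add"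
  shows "(\<Sum>u\<in>UNIV. f u) = (\<Sum>x\<in>UNIV. f (Inl x)) + (\<Sum>y\<in>UNIV. f (Inr y))"
  by (simp add: UNIV_Plus_UNIV [symmetric] sum.Plus del: UNIV_Plus_UNIV)

definition bichar_vec :: "('a \<Rightarrow> complex) \<Rightarrow> complex \<times> complex \<Rightarrow> complex ^ ('a::finite + 'a)" where
  "bichar_vec \<phi> p = (\<chi> u. case u of Inl x \<Rightarrow> fst p * \<phi> x | Inr x \<Rightarrow> snd p * \<phi> x)"

definition hermitian_op ::
  "complex \<Rightarrow> complex \<Rightarrow> complex \<Rightarrow> complex \<times> complex \<Rightarrow> complex \<times> complex" where
  "hermitian_op r l \<tau> p = (r * fst p + \<tau> * snd p, cnj \<tau> * fst p + l * snd p)"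

abbreviation bichar_op ::
  "('a \<Rightarrow> complex) \<Rightarrow> 'a set \<Rightarrow> 'a set \<Rightarrow> 'a set \<Rightarrow> complex \<times> complex \<Rightarrow> complex \<times> complex" where
  "bichar_op \<phi> R L T \<equiv> hermitian_op (char_sum \<phi> R) (char_sum \<phi> L) (char_sum \<phi> T)"

lemma adj_mat_BiCay:
  fixes R L T :: "'a::{finite, ab_group_add} set"
  assumes "uminus ` R = R" "uminus ` L = L"
  shows "adj_mat (BiCay R L T) $ Inl x $ Inl y = (if y - x \<in> R then 1 else 0)"
    and "adj_mat (BiCay R L T) $ Inr x $ Inr y = (if y - x \<in> L then 1 else 0)"
    and "adj_mat (BiCay R L T) $ Inl x $ Inr y = (if y - x \<in> T then 1 else 0)"
    and "adj_mat (BiCay R L T) $ Inr x $ Inl y = (if x - y \<in> T then 1 else 0)"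
proof -
  have "x - y \<in> R \<longleftrightarrow> y - x \<in> R" "x - y \<in> L \<longleftrightarrow> y - x \<in> L" for x y
    using assms by (metis image_eqI minus_diff_eq)+
  then show "adj_mat (BiCay R L T) $ Inl x $ Inl y = (if y - x \<in> R then 1 else 0)"
    and "adj_mat (BiCay R L T) $ Inr x $ Inr y = (if y - x \<in> L then 1 else 0)"
    and "adj_mat (BiCay R L T) $ Inl x $ Inr y = (if y - x \<in> T then 1 else 0)"
    and "adj_mat (BiCay R L T) $ Inr x $ Inl y = (if x - y \<in> T then 1 else 0)"
    by (auto simp: adj_mat_def BiCay_def doubleton_eq_iff)
qed

lemma sum_character_translate:
  fixes \<phi> :: "'a::{finite, ab_group_add} \<Rightarrow> complex"
  assumes "\<phi> \<in> characters"
  shows "(\<Sum>y\<in>UNIV. (if y - x \<in> S then 1 else 0) * (a * \<phi> y)) = a * \<phi> x * char_sum \<phi> S"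
    and "(\<Sum>y\<in>UNIV. (if x - y \<in> S then 1 else 0) * (a * \<phi> y)) = a * \<phi> x * cnj (char_sum \<phi> S)"
proof -
  have "(\<Sum>y\<in>UNIV. (if y - x \<in> S then 1 else 0) * (a * \<phi> y)) = (\<Sum>y | y - x \<in> S. a * \<phi> y)"
    by (simp add: sum.If_cases if_distrib [of "\<lambda>z. z * _"] cong: if_cong)
  also have "\<dots> = (\<Sum>s\<in>S. a * \<phi> (x + s))"
    by (rule sum.reindex_bij_witness [of _ "\<lambda>s. x + s" "\<lambda>y. y - x"]) auto
  finally show "(\<Sum>y\<in>UNIV. (if y - x \<in> S then 1 else 0) * (a * \<phi> y)) = a * \<phi> x * char_sum \<phi> S"
    by (simp add: char_sum_def character_add assms sum_distrib_left mult_ac)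
  have "(\<Sum>y\<in>UNIV. (if x - y \<in> S then 1 else 0) * (a * \<phi> y)) = (\<Sum>y | x - y \<in> S. a * \<phi> y)"
    by (simp add: sum.If_cases if_distrib [of "\<lambda>z. z * _"] cong: if_cong)
  also have "\<dots> = (\<Sum>s\<in>S. a * \<phi> (x + - s))"
    by (rule sum.reindex_bij_witness [of _ "\<lambda>s. x + - s" "\<lambda>y. x - y"]) auto
  finally show "(\<Sum>y\<in>UNIV. (if x - y \<in> S then 1 else 0) * (a * \<phi> y)) = a * \<phi> x * cnj (char_sum \<phi> S)"
    by (simp only: char_sum_def character_add character_uminus assms sum_distrib_left cnj_sum mult_ac)
qed

lemma adj_mat_BiCay_bichar_vec:
  fixes R L T :: "'a::{finite, ab_group_add} set"
  assumes "\<phi> \<in> characters" "uminus ` R = R" "uminus ` L = L"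
  shows "adj_mat (BiCay R L T) *v bichar_vec \<phi> p = bichar_vec \<phi> (bichar_op \<phi> R L T p)"
proof -
  have "(adj_mat (BiCay R L T) *v bichar_vec \<phi> p) $ u = bichar_vec \<phi> (bichar_op \<phi> R L T p) $ u" for u
    by (cases u; simp only: matrix_vector_mult_def sum_UNIV_Plus bichar_vec_def hermitian_op_def
        vec_lambda_beta sum.case adj_mat_BiCay assms sum_character_translate fst_conv snd_conv)
      (simp_all add: algebra_simps)
  then show ?thesis
    by (simp add: vec_eq_iff)
qed

lemma mat_pow_Suc: "mat_pow A (Suc m) = A ** mat_pow A m"
  by (simp add: mat_pow_def)

lemma mat_pow_adj_mat_BiCay_bichar_vec:
  fixes R L T :: "'a::{finite, ab_group_add} set"
  assumes "\<phi> \<in> characters" "uminus ` R = R" "uminus ` L = L"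
  shows "mat_pow (adj_mat (BiCay R L T)) m *v bichar_vec \<phi> p =
           bichar_vec \<phi> ((bichar_op \<phi> R L T ^^ m) p)"
proof (induction m)
  case 0
  show ?case by (simp add: mat_pow_def)
next
  case (Suc m)
  then show ?case
    by (simp add: mat_pow_Suc matrix_vector_mul_assoc [symmetric] adj_mat_BiCay_bichar_vec assms)
qed

lemma axis_eq_sum_bichar_vec:
  fixes \<psi> :: "nat \<Rightarrow> 'a::{finite, ab_group_add} \<Rightarrow> complex"
  assumes "bij_betw \<psi> {1..CARD('a)} characters"
  shows "of_nat CARD('a) *s axis (Inl g) 1 = (\<Sum>k=1..CARD('a). cnj (\<psi> k g) *s bichar_vec (\<psi> k) (1, 0))"
    and "of_nat CARD('a) *s axis (Inr g) 1 = (\<Sum>k=1..CARD('a). cnj (\<psi> k g) *s bichar_vec (\<psi> k) (0, 1))"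
  using character_orthogonality_dual [OF assms]
  by (auto simp: vec_eq_iff bichar_vec_def axis_def split_sum_all)

lemma matrix_vector_mult_axis: "(A *v axis v 1) $ u = A $ u $ v" for A :: "complex ^ 'n ^ 'm"
  by (simp add: matrix_vector_mult_def axis_def if_distrib cong: if_cong)

lemma matrix_vector_mult_sum:
  "A *v (\<Sum>k\<in>K. f k) = (\<Sum>k\<in>K. A *v f k)" for A :: "complex ^ 'n ^ 'm"
  by (induction K rule: infinite_finite_induct) (simp_all add: matrix_vector_right_distrib)

lemma mat_pow_adj_mat_BiCay_diag:
  fixes \<psi> :: "nat \<Rightarrow> 'a::{finite, ab_group_add} \<Rightarrow> complex" and R L T :: "'a set"
  assumes "bij_betw \<psi> {1..CARD('a)} characters" "uminus ` R = R" "uminus ` L = L"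
  defines "D \<equiv> adj_mat (BiCay R L T)"
  shows "of_nat CARD('a) * mat_pow D m $ Inl g $ Inl g =
           (\<Sum>k=1..CARD('a). fst ((bichar_op (\<psi> k) R L T ^^ m) (1, 0)))"
    and "of_nat CARD('a) * mat_pow D m $ Inr g $ Inr g =
           (\<Sum>k=1..CARD('a). snd ((bichar_op (\<psi> k) R L T ^^ m) (0, 1)))"
proof -
  have char: "\<psi> k \<in> characters" if "k \<in> {1..CARD('a)}" for k
    using assms(1) that by (auto simp: bij_betw_def)
  have *: "of_nat CARD('a) * mat_pow D m $ u $ v = (mat_pow D m *v (of_nat CARD('a) *s axis v 1)) $ u" for u v
    by (simp only: matrix_vector_mult_axis vector_scalar_commute vector_smult_component)
  have c: "cnj (\<psi> k g) * (z * \<psi> k g) = z" if "k \<in> {1..CARD('a)}" for k z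
    using character_mult_cnj [OF char [OF that], of g] by (simp add: mult_ac)
  show "of_nat CARD('a) * mat_pow D m $ Inl g $ Inl g =
           (\<Sum>k=1..CARD('a). fst ((bichar_op (\<psi> k) R L T ^^ m) (1, 0)))"
    unfolding * axis_eq_sum_bichar_vec [OF assms(1)] matrix_vector_mult_sum vector_scalar_commute sum_component
    by (intro sum.cong refl)
      (simp only: D_def mat_pow_adj_mat_BiCay_bichar_vec char assms(2,3) vector_smult_component;
       simp add: bichar_vec_def c)
  show "of_nat CARD('a) * mat_pow D m $ Inr g $ Inr g =
           (\<Sum>k=1..CARD('a). snd ((bichar_op (\<psi> k) R L T ^^ m) (0, 1)))"
    unfolding * axis_eq_sum_bichar_vec [OF assms(1)] matrix_vector_mult_sum vector_scalar_commute sum_component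
    by (intro sum.cong refl)
      (simp only: D_def mat_pow_adj_mat_BiCay_bichar_vec char assms(2,3) vector_smult_component;
       simp add: bichar_vec_def c)
qed

lemma norm_mat_pow_le:
  fixes A :: "complex ^ 'v ^ 'v::finite"
  assumes "\<And>u v. cmod (A $ u $ v) \<le> b"
  shows "cmod (mat_pow A m $ u $ v) \<le> (real CARD('v) * b) ^ m"
proof (induction m arbitrary: u)
  case 0
  show ?case by (simp add: mat_pow_def mat_def)
next
  case (Suc m)
  have "cmod (mat_pow A (Suc m) $ u $ v) \<le> (\<Sum>w\<in>UNIV. cmod (A $ u $ w * mat_pow A m $ w $ v))"
    unfolding mat_pow_Suc matrix_matrix_mult_def vec_lambda_beta by (rule norm_sum)
  also have "\<dots> \<le> (\<Sum>w\<in>(UNIV :: 'v set). b * (real CARD('v) * b) ^ m)"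
    unfolding norm_mult by (intro sum_mono mult_mono assms Suc order_trans [OF norm_ge_zero assms] norm_ge_zero)
  finally show ?case by simp
qed

lemma sums_vec:
  fixes f :: "nat \<Rightarrow> 'b::real_normed_vector ^ 'n::finite"
  assumes "\<And>i. (\<lambda>m. f m $ i) sums (x $ i)"
  shows "f sums x"
  using assms unfolding sums_def by (intro vec_tendstoI) simp

lemma mat_exp_component:
  "mat_exp A $ u $ v = (\<Sum>m. mat_pow A m $ u $ v / fact m)"
proof -
  define b where "b = (\<Sum>u\<in>UNIV. \<Sum>v\<in>UNIV. cmod (A $ u $ v))"
  have "cmod (A $ u $ v) \<le> (\<Sum>v\<in>UNIV. cmod (A $ u $ v))" for u v
    by (rule member_le_sum) auto
  also have "(\<Sum>v\<in>UNIV. cmod (A $ u $ v)) \<le> b" for u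
    unfolding b_def by (rule member_le_sum [of _ _ "\<lambda>u. \<Sum>v\<in>UNIV. cmod (A $ u $ v)"]) (auto intro: sum_nonneg)
  finally have b: "cmod (A $ u $ v) \<le> b" for u v .
  have summable: "summable (\<lambda>m. mat_pow A m $ u $ v / fact m)" for u v
  proof (rule summable_comparison_test)
    show "summable (\<lambda>m. inverse (fact m) * (real CARD('a) * b) ^ m)"
      by (rule summable_exp)
    show "\<exists>N. \<forall>m\<ge>N. norm (mat_pow A m $ u $ v / fact m) \<le> inverse (fact m) * (real CARD('a) * b) ^ m"
      using norm_mat_pow_le [of A b, OF b] by (simp add: norm_divide field_simps)
  qed
  have "(\<lambda>m. (1 / fact m) *\<^sub>R mat_pow A m) sums (\<chi> u v. \<Sum>m. mat_pow A m $ u $ v / fact m)"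
    using summable_sums [OF summable] by (intro sums_vec) (simp only: vector_scaleR_component vec_lambda_beta; simp add: scaleR_conv_of_real)
  then show ?thesis
    by (simp add: mat_exp_def sums_unique [symmetric])
qed

lemma mat_pow_scale:
  "mat_pow (\<chi> u v. a * A $ u $ v) m $ u $ v = a ^ m * mat_pow A m $ u $ v"
proof (induction m arbitrary: u)
  case 0
  show ?case by (simp add: mat_pow_def)
next
  case (Suc m)
  then show ?case
    by (simp add: mat_pow_Suc matrix_matrix_mult_def sum_distrib_left mult_ac)
qed

lemma transition_mat_eq_sum:
  fixes w \<theta> :: "'j \<Rightarrow> real"
  assumes "\<And>m. mat_pow (adj_mat E) m $ u $ v = (\<Sum>j\<in>J. of_real (w j) * of_real (\<theta> j) ^ m)"
  shows "transition_mat E t $ u $ v = (\<Sum>j\<in>J. of_real (w j) * cis (- t * \<theta> j))"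
proof -
  have "(\<lambda>m. \<Sum>j\<in>J. of_real (w j) * ((- \<i> * of_real t * of_real (\<theta> j)) ^ m /\<^sub>R fact m)) sums
      (\<Sum>j\<in>J. of_real (w j) * exp (- \<i> * of_real t * of_real (\<theta> j)))"
    by (intro sums_sum sums_mult exp_converges)
  also have "(\<lambda>m. \<Sum>j\<in>J. of_real (w j) * ((- \<i> * of_real t * of_real (\<theta> j)) ^ m /\<^sub>R fact m)) =
      (\<lambda>m. (- \<i> * of_real t) ^ m * mat_pow (adj_mat E) m $ u $ v / fact m)"
    unfolding assms sum_distrib_left sum_divide_distrib
      power_mult_distrib [of "- \<i> * of_real t" "of_real (\<theta> _)"]
    by (intro ext sum.cong refl) (simp add: scaleR_conv_of_real divide_inverse mult_ac)
  finally have "transition_mat E t $ u $ v =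
      (\<Sum>j\<in>J. of_real (w j) * exp (- \<i> * of_real t * of_real (\<theta> j)))"
    unfolding transition_mat_def mat_exp_component mat_pow_scale by (rule sums_unique [symmetric])
  then show ?thesis
    by (simp add: cis_conv_exp mult_ac)
qed

lemma norm_convex_sum_eq_1_iff:
  fixes z :: "'j \<Rightarrow> complex" and w :: "'j \<Rightarrow> real"
  assumes "finite J" "\<And>j. j \<in> J \<Longrightarrow> w j > 0" "(\<Sum>j\<in>J. w j) = 1" "\<And>j. j \<in> J \<Longrightarrow> cmod (z j) = 1"
  shows "cmod (\<Sum>j\<in>J. of_real (w j) * z j) = 1 \<longleftrightarrow> (\<forall>i\<in>J. \<forall>j\<in>J. z i = z j)"
proof
  assume eq: "\<forall>i\<in>J. \<forall>j\<in>J. z i = z j"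
  obtain i where i: "i \<in> J"
    using assms(3) by (cases "J = {}") auto
  then have "z j = z i" if "j \<in> J" for j
    using eq that by blast
  then have "(\<Sum>j\<in>J. of_real (w j) * z j) = of_real (\<Sum>j\<in>J. w j) * z i"
    unfolding of_real_sum sum_distrib_right by (intro sum.cong) simp_all
  then show "cmod (\<Sum>j\<in>J. of_real (w j) * z j) = 1"
    using assms(3,4) i by simp
next
  define S where "S = (\<Sum>j\<in>J. of_real (w j) * z j)"
  assume "cmod (\<Sum>j\<in>J. of_real (w j) * z j) = 1"
  then have S: "cmod S = 1"
    by (simp add: S_def)
  have le: "Re (cnj S * z j) \<le> 1" if "j \<in> J" for j
    using complex_Re_le_cmod [of "cnj S * z j"] S assms(4) [OF that] by (simp add: norm_mult)
  have "(\<Sum>j\<in>J. w j * Re (cnj S * z j)) = Re (cnj S * S)"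
    by (simp add: S_def sum_distrib_left Re_sum) (simp add: algebra_simps sum_distrib_left sum.distrib)
  also have "\<dots> = 1"
    using S by (metis complex_norm_square mult.commute Re_complex_of_real power_one of_real_1 one_complex.sel(1))
  finally have "(\<Sum>j\<in>J. w j * (1 - Re (cnj S * z j))) = 0"
    using assms(3) by (simp add: right_diff_distrib sum_subtractf)
  moreover have "w j * (1 - Re (cnj S * z j)) \<ge> 0" if "j \<in> J" for j
    using le [OF that] assms(2) [OF that] by simp
  ultimately have "\<forall>j\<in>J. w j * (1 - Re (cnj S * z j)) = 0"
    using sum_nonneg_eq_0_iff [OF assms(1), of "\<lambda>j. w j * (1 - Re (cnj S * z j))"] by blast
  then have re: "Re (cnj S * z j) = 1" if "j \<in> J" for j
    using assms(2) [OF that] that by (metis eq_iff_diff_eq_0 less_irrefl mult_eq_0_iff)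
  have "z j = S" if "j \<in> J" for j
  proof -
    have "cmod (z j - S) ^ 2 = (cmod (z j))\<^sup>2 + (cmod S)\<^sup>2 - 2 * Re (cnj S * z j)"
      unfolding cmod_power2 by (simp add: power2_eq_square algebra_simps)
    then show ?thesis
      unfolding S re [OF that] assms(4) [OF that] by simp
  qed
  then show "\<forall>i\<in>J. \<forall>j\<in>J. z i = z j"
    by metis
qed

definition two_pi_Ints :: "real set" where
  "two_pi_Ints = range (\<lambda>z. 2 * pi * of_int z)"

lemma cis_eq_cis_iff: "cis a = cis b \<longleftrightarrow> b - a \<in> two_pi_Ints"
proof -
  have "cis a = cis b \<longleftrightarrow> cis (b - a) = 1"
    by (auto simp: cis_divide [symmetric])
  also have "\<dots> \<longleftrightarrow> (\<exists>k::int. b - a = 2 * pi * of_int k)"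
    by (auto simp: cis_conv_exp exp_eq_1 mult_ac)
  finally show ?thesis
    by (auto simp: two_pi_Ints_def)
qed

lemma periodic_at_iff_differences:
  fixes w \<theta> :: "'j \<Rightarrow> real"
  assumes "finite J" "\<And>j. j \<in> J \<Longrightarrow> w j > 0"
    and "\<And>m. mat_pow (adj_mat E) m $ u $ u = (\<Sum>j\<in>J. of_real (w j) * of_real (\<theta> j) ^ m)"
  shows "periodic_at E u t \<longleftrightarrow> t \<noteq> 0 \<and> (\<forall>x\<in>\<theta> ` J. \<forall>y\<in>\<theta> ` J. t * (x - y) \<in> two_pi_Ints)"
proof -
  have "complex_of_real (\<Sum>j\<in>J. w j) = 1"
    using assms(3) [of 0] by (simp add: mat_pow_def mat_def)
  then have "(\<Sum>j\<in>J. w j) = 1"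
    by (simp only: of_real_eq_1_iff)
  then show ?thesis
    unfolding periodic_at_def transition_mat_eq_sum [OF assms(3)]
    by (subst norm_convex_sum_eq_1_iff [OF assms(1,2)]) (auto simp: cis_eq_cis_iff algebra_simps)
qed

lemma two_pi_Ints_diff: "x \<in> two_pi_Ints \<Longrightarrow> y \<in> two_pi_Ints \<Longrightarrow> x - y \<in> two_pi_Ints"
  unfolding two_pi_Ints_def
proof clarify
  fix a b :: int
  show "2 * pi * of_int a - 2 * pi * of_int b \<in> range (\<lambda>z. 2 * pi * of_int z)"
    by (rule range_eqI [of _ _ "a - b"]) (simp add: right_diff_distrib)
qed

lemma two_pi_Ints_zero: "0 \<in> two_pi_Ints"
  unfolding two_pi_Ints_def by (rule range_eqI [of _ _ 0]) simp

lemma two_pi_Ints_minus: "x \<in> two_pi_Ints \<Longrightarrow> - x \<in> two_pi_Ints"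
  using two_pi_Ints_diff [OF two_pi_Ints_zero, of x] by simp

lemma two_pi_Ints_mult_int: "x \<in> two_pi_Ints \<Longrightarrow> of_int z * x \<in> two_pi_Ints"
  unfolding two_pi_Ints_def
proof clarify
  fix a :: int
  show "of_int z * (2 * pi * of_int a) \<in> range (\<lambda>z. 2 * pi * of_int z)"
    by (rule range_eqI [of _ _ "z * a"]) (simp add: mult_ac)
qed

lemma period_times_iff: "t \<in> period_times M \<longleftrightarrow> t \<noteq> 0 \<and> t * of_int M \<in> two_pi_Ints"
proof (cases "M = 0")
  case True
  then show ?thesis by (simp add: period_times_def two_pi_Ints_zero)
next
  case False
  then show ?thesis by (auto simp: period_times_def two_pi_Ints_def field_simps image_iff)
qed

lemma mult_Gcd_in_two_pi_Ints_iff: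
  fixes A :: "int set"
  shows "t * of_int (Gcd A) \<in> two_pi_Ints \<longleftrightarrow> (\<forall>a\<in>A. t * of_int a \<in> two_pi_Ints)"
proof
  assume *: "t * of_int (Gcd A) \<in> two_pi_Ints"
  show "\<forall>a\<in>A. t * of_int a \<in> two_pi_Ints"
  proof
    fix a assume "a \<in> A"
    then have "Gcd A dvd a" by simp
    then obtain z where "a = z * Gcd A" by (metis dvd_def mult.commute)
    then show "t * of_int a \<in> two_pi_Ints"
      using two_pi_Ints_mult_int [OF *, of z] by (simp add: mult_ac)
  qed
next
  assume *: "\<forall>a\<in>A. t * of_int a \<in> two_pi_Ints"
  \<comment> \<open>The multipliers that work form an ideal of the integers, which is principal.\<close>
  define I where "I = {a :: int. t * of_int a \<in> two_pi_Ints}"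
  have "\<exists>d\<in>I. \<forall>a\<in>I. d dvd a"
  proof (cases "I \<subseteq> {0}")
    case True
    then show ?thesis
      by (intro bexI [of _ 0]) (auto simp: I_def two_pi_Ints_zero)
  next
    case False
    have neg: "- a \<in> I" if "a \<in> I" for a
      using that two_pi_Ints_minus by (fastforce simp: I_def)
    obtain a where "a \<in> I" "a \<noteq> 0"
      using False by auto
    then have "\<exists>n>0. int n \<in> I"
      using neg by (intro exI [of _ "nat \<bar>a\<bar>"]) (auto simp: abs_if)
    then obtain n where n: "n > 0 \<and> int n \<in> I" and least: "\<And>m. m < n \<Longrightarrow> \<not> (m > 0 \<and> int m \<in> I)"
      using exists_least_iff [of "\<lambda>n. n > 0 \<and> int n \<in> I"] by auto
    have "int n dvd b" if "b \<in> I" for b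
    proof -
      have "t * of_int (b mod int n) = t * of_int b - of_int (b div int n) * (t * of_int (int n))"
        by (simp add: minus_div_mult_eq_mod [symmetric] algebra_simps)
      also have "\<dots> \<in> two_pi_Ints"
        using that n unfolding I_def by (intro two_pi_Ints_diff two_pi_Ints_mult_int) auto
      finally have "b mod int n \<in> I"
        by (simp add: I_def)
      moreover have "0 \<le> b mod int n" "b mod int n < int n"
        using n by simp_all
      ultimately have "b mod int n = 0"
        using least [of "nat (b mod int n)"] by fastforce
      then show ?thesis by (rule mod_0_imp_dvd)
    qed
    then show ?thesis using n by blast
  qed
  then obtain d where "d \<in> I" and d: "\<And>a. a \<in> I \<Longrightarrow> d dvd a"
    by blast
  have "d dvd Gcd A"
    using * by (intro Gcd_greatest d) (simp add: I_def)
  then obtain z where "Gcd A = z * d" by (metis dvd_def mult.commute)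
  then show "t * of_int (Gcd A) \<in> two_pi_Ints"
    using two_pi_Ints_mult_int [of "t * of_int d" z] \<open>d \<in> I\<close> by (simp add: I_def mult_ac)
qed

lemma period_times_gcd: "t \<in> period_times (gcd a b) \<longleftrightarrow> t \<in> period_times a \<and> t \<in> period_times b"
proof -
  have "gcd a b = Gcd {a, b}"
    by simp
  then show ?thesis
    unfolding period_times_iff by (simp only: mult_Gcd_in_two_pi_Ints_iff) blast
qed

lemma period_times_gcd_set:
  assumes "S \<subseteq> \<int>"
  shows "t \<in> period_times (gcd_set S) \<longleftrightarrow> t \<noteq> 0 \<and> (\<forall>x\<in>S. t * x \<in> two_pi_Ints)"
proof -
  have "(\<forall>m\<in>{m. of_int m \<in> S}. t * of_int m \<in> two_pi_Ints) \<longleftrightarrow> (\<forall>x\<in>S. t * x \<in> two_pi_Ints)"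
    using assms by (metis Ints_cases mem_Collect_eq subsetD)
  then show ?thesis
    by (simp only: period_times_iff gcd_set_def mult_Gcd_in_two_pi_Ints_iff)
qed

lemma hermitian_op_pow:
  fixes r l :: real and \<tau> :: complex
  assumes "\<tau> \<noteq> 0"
  defines "s \<equiv> sqrt ((r - l)\<^sup>2 + 4 * (cmod \<tau>)\<^sup>2)"
  defines "\<alpha> \<equiv> (r + l + s) / 2" and "\<beta> \<equiv> (r + l - s) / 2"
  shows "s > 0" "\<beta> < r" "r < \<alpha>"
    and "(hermitian_op (of_real r) (of_real l) \<tau> ^^ m) (1, 0) =
      (of_real ((r - \<beta>) / s) * of_real \<alpha> ^ m + of_real ((\<alpha> - r) / s) * of_real \<beta> ^ m,
       cnj \<tau> / of_real s * (of_real \<alpha> ^ m - of_real \<beta> ^ m))" (is "_ = ?rhs m")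
proof -
  have "\<bar>r - l\<bar> < s"
    unfolding s_def using assms(1) by (intro real_less_rsqrt) simp
  then show s: "s > 0" and "\<beta> < r" "r < \<alpha>"
    by (auto simp: \<alpha>_def \<beta>_def)
  have s2: "s\<^sup>2 = (r - l)\<^sup>2 + 4 * (cmod \<tau>)\<^sup>2"
    unfolding s_def by simp
  have "(r - \<beta>) * (\<alpha> - r) = (s\<^sup>2 - (r - l)\<^sup>2) / 4"
    by (simp add: \<alpha>_def \<beta>_def power2_eq_square field_simps)
  then have prod: "(r - \<beta>) * (\<alpha> - r) = (cmod \<tau>)\<^sup>2"
    by (simp add: s2)
  have prodc: "\<tau> * cnj \<tau> = of_real ((r - \<beta>) * (\<alpha> - r))"
    unfolding prod by (rule complex_norm_square [symmetric])
  have l: "l = \<alpha> + \<beta> - r" and sab: "s = \<alpha> - \<beta>"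
    by (simp_all add: \<alpha>_def \<beta>_def field_simps)
  show "(hermitian_op (of_real r) (of_real l) \<tau> ^^ m) (1, 0) = ?rhs m"
  proof (induction m)
    case 0
    show ?case using s by (simp add: sab field_simps flip: of_real_add of_real_diff)
  next
    case (Suc m)
    define A B :: complex where "A = of_real \<alpha> ^ m" and "B = of_real \<beta> ^ m"
    have sc: "complex_of_real \<alpha> - of_real \<beta> \<noteq> 0"
      using s by (simp add: sab flip: of_real_diff)
    have "(of_real r * (of_real ((r - \<beta>) / s) * A + of_real ((\<alpha> - r) / s) * B) +
        \<tau> * (cnj \<tau> / of_real s * (A - B))) =
        of_real ((r - \<beta>) / s) * (of_real \<alpha> * A) + of_real ((\<alpha> - r) / s) * (of_real \<beta> * B)"
    proof -
      have *: "\<tau> * (cnj \<tau> / of_real s * (A - B)) = of_real ((r - \<beta>) * (\<alpha> - r)) / of_real s * (A - B)"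
        unfolding prodc [symmetric] by simp
      show ?thesis
        unfolding * using sc by (simp add: sab divide_simps) (simp add: algebra_simps)
    qed
    moreover have "cnj \<tau> * (of_real ((r - \<beta>) / s) * A + of_real ((\<alpha> - r) / s) * B) +
        of_real l * (cnj \<tau> / of_real s * (A - B)) =
        cnj \<tau> / of_real s * (of_real \<alpha> * A - of_real \<beta> * B)"
      using sc by (simp add: sab l divide_simps) (simp add: algebra_simps)
    ultimately show ?case
      unfolding funpow.simps comp_apply Suc.IH by (simp only: hermitian_op_def A_def B_def fst_conv snd_conv power_Suc)
  qed
qed

lemma fst_hermitian_op_pow:
  fixes r l :: real and \<tau> :: complex
  defines "s \<equiv> sqrt ((r - l)\<^sup>2 + 4 * (cmod \<tau>)\<^sup>2)"
  shows "\<exists>p q :: real. p > 0 \<and> q > 0 \<and>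
    (\<forall>m. fst ((hermitian_op (of_real r) (of_real l) \<tau> ^^ m) (1, 0)) =
      of_real p * of_real (if \<tau> = 0 then r else (r + l + s) / 2) ^ m +
      of_real q * of_real (if \<tau> = 0 then r else (r + l - s) / 2) ^ m)"
proof (cases "\<tau> = 0")
  case True
  have "(hermitian_op (of_real r) (of_real l) 0 ^^ m) (1, 0) = (of_real r ^ m, 0)" for m
    by (induction m) (simp_all add: hermitian_op_def)
  then show ?thesis
    using True by (intro exI [of _ "1 / 2"]) simp
next
  case False
  then show ?thesis
    using hermitian_op_pow [OF False, where r = r and l = l]
    by (intro exI [of _ "(r - (r + l - s) / 2) / s"] exI [of _ "((r + l + s) / 2 - r) / s"])
      (simp add: s_def)
qed

lemma snd_hermitian_op_pow:
  "snd ((hermitian_op r l \<tau> ^^ m) (0, 1)) = fst ((hermitian_op l r (cnj \<tau>) ^^ m) (1, 0))"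
proof -
  have "(hermitian_op r l \<tau> ^^ m) (0, 1) = prod.swap ((hermitian_op l r (cnj \<tau>) ^^ m) (1, 0))"
    by (induction m) (simp_all add: hermitian_op_def add.commute)
  then show ?thesis by simp
qed

lemma lam_even:
  "lam \<psi> R L T (2 * k) =
    (Re (char_sum (\<psi> k) R) + Re (char_sum (\<psi> k) L) +
     sqrt ((Re (char_sum (\<psi> k) R) - Re (char_sum (\<psi> k) L))\<^sup>2 + 4 * (cmod (char_sum (\<psi> k) T))\<^sup>2)) / 2"
  by (simp add: lam_def Let_def)

lemma lam_odd:
  assumes "k \<ge> 1"
  shows "lam \<psi> R L T (2 * k - 1) =
    (Re (char_sum (\<psi> k) R) + Re (char_sum (\<psi> k) L) -
     sqrt ((Re (char_sum (\<psi> k) R) - Re (char_sum (\<psi> k) L))\<^sup>2 + 4 * (cmod (char_sum (\<psi> k) T))\<^sup>2)) / 2"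
proof -
  have "(2 * k - 1 + 1) div 2 = k" "odd (2 * k - 1)"
    using assms by simp_all
  then show ?thesis
    by (simp add: lam_def Let_def)
qed

text \<open>The eigenvalues of the graph whose eigenspaces are not orthogonal to the vertices of the copy
  of the group that carries \<open>X\<close>.\<close>

definition eigenvalue_support ::
  "(nat \<Rightarrow> 'a::finite \<Rightarrow> complex) \<Rightarrow> 'a set \<Rightarrow> 'a set \<Rightarrow> 'a set \<Rightarrow> 'a set \<Rightarrow> real set" where
  "eigenvalue_support \<psi> R L T X =
     (\<Union>k\<in>{1..CARD('a)}. if k \<in> Hset \<psi> T then {Re (char_sum (\<psi> k) X)}
        else {lam \<psi> R L T (2 * k), lam \<psi> R L T (2 * k - 1)})"

lemma periodic_at_iff_pairs:
  fixes x y :: "nat \<Rightarrow> real"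
  assumes "finite K" "n > 0"
    and "\<And>m. of_nat n * mat_pow (adj_mat E) m $ u $ u = (\<Sum>k\<in>K. d k m)"
    and "\<And>k. k \<in> K \<Longrightarrow> \<exists>p q :: real. p > 0 \<and> q > 0 \<and>
           (\<forall>m. d k m = of_real p * of_real (x k) ^ m + of_real q * of_real (y k) ^ m)"
  shows "periodic_at E u t \<longleftrightarrow>
    t \<noteq> 0 \<and> (\<forall>a\<in>(\<Union>k\<in>K. {x k, y k}). \<forall>b\<in>(\<Union>k\<in>K. {x k, y k}). t * (a - b) \<in> two_pi_Ints)"
proof -
  obtain p q :: "nat \<Rightarrow> real" where pq: "\<And>k. k \<in> K \<Longrightarrow> p k > 0 \<and> q k > 0 \<and>
      (\<forall>m. d k m = of_real (p k) * of_real (x k) ^ m + of_real (q k) * of_real (y k) ^ m)"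
    using assms(4) by metis
  define w where "w = (\<lambda>(k, b). (if b then p k else q k) / real n)"
  define \<theta> where "\<theta> = (\<lambda>(k, b). if b then x k else y k)"
  let ?J = "K \<times> (UNIV :: bool set)"
  have "mat_pow (adj_mat E) m $ u $ u = (\<Sum>j\<in>?J. of_real (w j) * of_real (\<theta> j) ^ m)" for m
  proof -
    have "mat_pow (adj_mat E) m $ u $ u = (\<Sum>k\<in>K. d k m / of_nat n)"
      using assms(3) [of m] assms(2) by (simp add: sum_divide_distrib [symmetric] field_simps)
    also have "\<dots> = (\<Sum>k\<in>K. \<Sum>b\<in>UNIV. of_real (w (k, b)) * of_real (\<theta> (k, b)) ^ m)"
      by (intro sum.cong refl) (simp add: pq w_def \<theta>_def UNIV_bool add_divide_distrib)
    finally show ?thesis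
      by (simp add: sum.cartesian_product)
  qed
  then have "periodic_at E u t \<longleftrightarrow>
      t \<noteq> 0 \<and> (\<forall>a\<in>\<theta> ` ?J. \<forall>b\<in>\<theta> ` ?J. t * (a - b) \<in> two_pi_Ints)"
    using assms(1,2) pq by (intro periodic_at_iff_differences [of _ w]) (auto simp: w_def)
  moreover have "\<theta> ` ?J = (\<Union>k\<in>K. {x k, y k})"
    by (force simp: \<theta>_def UNIV_bool)
  ultimately show ?thesis by simp
qed

lemma periodic_at_BiCay:
  fixes \<psi> :: "nat \<Rightarrow> 'a::{finite, ab_group_add} \<Rightarrow> complex" and R L T :: "'a set"
  assumes "bij_betw \<psi> {1..CARD('a)} characters" "uminus ` R = R" "uminus ` L = L"
  shows "periodic_at (BiCay R L T) (Inl g) t \<longleftrightarrow> t \<noteq> 0 \<and>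
      (\<forall>x\<in>eigenvalue_support \<psi> R L T R. \<forall>y\<in>eigenvalue_support \<psi> R L T R. t * (x - y) \<in> two_pi_Ints)"
    and "periodic_at (BiCay R L T) (Inr g) t \<longleftrightarrow> t \<noteq> 0 \<and>
      (\<forall>x\<in>eigenvalue_support \<psi> R L T L. \<forall>y\<in>eigenvalue_support \<psi> R L T L. t * (x - y) \<in> two_pi_Ints)"
proof -
  have char: "\<psi> k \<in> characters" if "k \<in> {1..CARD('a)}" for k
    using assms(1) that by (auto simp: bij_betw_def)
  have real: "char_sum (\<psi> k) R = of_real (Re (char_sum (\<psi> k) R))"
    "char_sum (\<psi> k) L = of_real (Re (char_sum (\<psi> k) L))" if "k \<in> {1..CARD('a)}" for k
    using char_sum_in_Reals [OF char [OF that]] assms(2,3) by simp_all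
  define x where "x X k = (if char_sum (\<psi> k) T = 0 then Re (char_sum (\<psi> k) X)
    else lam \<psi> R L T (2 * k))" for X k
  define y where "y X k = (if char_sum (\<psi> k) T = 0 then Re (char_sum (\<psi> k) X)
    else lam \<psi> R L T (2 * k - 1))" for X k
  have supp: "eigenvalue_support \<psi> R L T X = (\<Union>k\<in>{1..CARD('a)}. {x X k, y X k})" for X
    unfolding eigenvalue_support_def by (intro SUP_cong refl) (simp add: x_def y_def Hset_def)
  show "periodic_at (BiCay R L T) (Inl g) t \<longleftrightarrow> t \<noteq> 0 \<and>
      (\<forall>x\<in>eigenvalue_support \<psi> R L T R. \<forall>y\<in>eigenvalue_support \<psi> R L T R. t * (x - y) \<in> two_pi_Ints)"
    unfolding supp
  proof (rule periodic_at_iff_pairs [OF _ _ mat_pow_adj_mat_BiCay_diag(1) [OF assms]])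
    fix k assume k: "k \<in> {1..CARD('a)}"
    then show "\<exists>p q :: real. p > 0 \<and> q > 0 \<and> (\<forall>m. fst ((bichar_op (\<psi> k) R L T ^^ m) (1, 0)) =
        of_real p * of_real (x R k) ^ m + of_real q * of_real (y R k) ^ m)"
      using fst_hermitian_op_pow [of "Re (char_sum (\<psi> k) R)" "Re (char_sum (\<psi> k) L)" "char_sum (\<psi> k) T"]
      by (simp only: real [OF k, symmetric] x_def y_def lam_even lam_odd atLeastAtMost_iff)
  qed simp_all
  show "periodic_at (BiCay R L T) (Inr g) t \<longleftrightarrow> t \<noteq> 0 \<and>
      (\<forall>x\<in>eigenvalue_support \<psi> R L T L. \<forall>y\<in>eigenvalue_support \<psi> R L T L. t * (x - y) \<in> two_pi_Ints)"
    unfolding supp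
  proof (rule periodic_at_iff_pairs [OF _ _ mat_pow_adj_mat_BiCay_diag(2) [OF assms]])
    fix k assume k: "k \<in> {1..CARD('a)}"
    then show "\<exists>p q :: real. p > 0 \<and> q > 0 \<and> (\<forall>m. snd ((bichar_op (\<psi> k) R L T ^^ m) (0, 1)) =
        of_real p * of_real (x L k) ^ m + of_real q * of_real (y L k) ^ m)"
      using fst_hermitian_op_pow [of "Re (char_sum (\<psi> k) L)" "Re (char_sum (\<psi> k) R)" "cnj (char_sum (\<psi> k) T)"]
      by (simp only: real [OF k, symmetric] x_def y_def lam_even lam_odd atLeastAtMost_iff
          snd_hermitian_op_pow complex_mod_cnj complex_cnj_zero_iff add.commute
          power2_commute [of "Re (char_sum (\<psi> k) L)"])
  qed simp_all
qed

lemma det_cong_dvd: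
  fixes A B :: "int ^ 'n ^ 'n::finite"
  assumes "\<And>i j. q dvd A $ i $ j - B $ i $ j"
  shows "q dvd det A - det B"
proof -
  have "A $ i $ j mod q = B $ i $ j mod q" for i j
    using assms by (simp add: mod_eq_dvd_iff)
  then have "(\<Prod>i\<in>UNIV. A $ i $ p i) mod q = (\<Prod>i\<in>UNIV. B $ i $ p i) mod q" for p :: "'n \<Rightarrow> 'n"
    using mod_prod_eq [of "\<lambda>i. A $ i $ p i" q UNIV] mod_prod_eq [of "\<lambda>i. B $ i $ p i" q UNIV] by simp
  then have "q dvd (\<Prod>i\<in>UNIV. A $ i $ p i) - (\<Prod>i\<in>UNIV. B $ i $ p i)" for p :: "'n \<Rightarrow> 'n"
    by (simp add: mod_eq_dvd_iff)
  then show ?thesis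
    unfolding det_def sum_subtractf [symmetric] right_diff_distrib [symmetric]
    by (intro dvd_sum dvd_mult) auto
qed

lemma det_of_int: "det (\<chi> i j. of_int (A $ i $ j)) = (of_int (det A) :: 'c::comm_ring_1)"
  by (simp add: det_def)

text \<open>If \<open>p / q\<close> is an eigenvalue in lowest terms, then \<open>0 = det (p I - q A) \<equiv> p\<^sup>n\<close> modulo \<open>q\<close>.\<close>

lemma rational_eigenvalue_adj_mat_in_Ints:
  fixes E :: "'v::finite set set" and x :: real
  assumes "mat_eigenvalue (adj_mat E) (of_real x)" "x \<in> \<rat>"
  shows "x \<in> \<int>"
proof -
  obtain p q where q: "q > 0" and "coprime p q" and x: "x = of_int p / of_int q"
    using assms(2) by (rule Rats_cases')
  define a :: "'v \<Rightarrow> 'v \<Rightarrow> int" where "a = (\<lambda>u v. if {u, v} \<in> E then 1 else 0)"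
  define N :: "int ^ 'v ^ 'v" where "N = (\<chi> u v. (if u = v then p else 0) - q * a u v)"
  define C :: "complex ^ 'v ^ 'v" where "C = (\<chi> u v. of_int (N $ u $ v))"
  obtain v where v: "v \<noteq> 0" "adj_mat E *v v = of_real x *s v"
    using assms(1) by (auto simp: mat_eigenvalue_def)
  have "(C *v v) $ u = of_int p * v $ u - of_int q * (adj_mat E *v v) $ u" for u
  proof -
    have "(C *v v) $ u = (\<Sum>w\<in>UNIV. (if u = w then of_int p * v $ w else 0) -
        of_int q * (adj_mat E $ u $ w * v $ w))"
      unfolding C_def N_def matrix_vector_mult_def vec_lambda_beta
      by (intro sum.cong refl) (simp add: a_def adj_mat_def algebra_simps)
    also have "\<dots> = of_int p * v $ u - of_int q * (adj_mat E *v v) $ u"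
      by (simp add: sum_subtractf sum_distrib_left matrix_vector_mult_def)
    finally show ?thesis .
  qed
  then have "C *v v = 0"
    using q by (simp add: vec_eq_iff v(2) x)
  then have "\<not> invertible C"
    using v(1) matrix_left_invertible_ker [of C] by (auto simp: invertible_def)
  then have "of_int (det N) = (0 :: complex)"
    by (simp add: invertible_det_nz C_def det_of_int)
  then have "det N = 0"
    by simp
  moreover have "q dvd det N - det ((\<chi> u v. if u = v then p else 0) :: int ^ 'v ^ 'v)"
    by (rule det_cong_dvd) (simp add: N_def)
  moreover have "det ((\<chi> u v. if u = v then p else 0) :: int ^ 'v ^ 'v) = p ^ CARD('v)"
    by (subst det_diagonal) simp_all
  ultimately have "q dvd p ^ CARD('v)"
    by simp
  moreover have "coprime (p ^ CARD('v)) q"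
    using \<open>coprime p q\<close> by simp
  ultimately have "q = 1"
    using q by (metis coprime_absorb_right zdvd1_eq abs_of_pos int_one_le_iff_zero_less order_less_imp_le)
  then show ?thesis
    by (simp add: x)
qed

lemma adj_mat_commute: "adj_mat E $ u $ v = adj_mat E $ v $ u"
  by (simp add: adj_mat_def insert_commute)

lemma quadratic_roots:
  fixes r l d c :: "'b::field_char_0"
  assumes "s\<^sup>2 = (r - l)\<^sup>2 + 4 * d"
  shows "(c - r) * (c - l) = d \<longleftrightarrow> c = (r + l + s) / 2 \<or> c = (r + l - s) / 2"
proof -
  have "4 * ((c - r) * (c - l) - d) = (2 * c - (r + l + s)) * (2 * c - (r + l - s)) + (s\<^sup>2 - (r - l)\<^sup>2 - 4 * d)"
    by (simp add: power2_eq_square algebra_simps)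
  then have "4 * ((c - r) * (c - l) - d) = (2 * c - (r + l + s)) * (2 * c - (r + l - s))"
    by (simp add: assms)
  then have "(c - r) * (c - l) = d \<longleftrightarrow> 2 * c - (r + l + s) = 0 \<or> 2 * c - (r + l - s) = 0"
    by (metis eq_iff_diff_eq_0 mult_eq_0_iff zero_neq_numeral)
  then show ?thesis
    by (simp add: field_simps)
qed

lemma mat_eigenvalue_BiCay:
  fixes \<psi> :: "nat \<Rightarrow> 'a::{finite, ab_group_add} \<Rightarrow> complex" and R L T :: "'a set"
  assumes "bij_betw \<psi> {1..CARD('a)} characters" "uminus ` R = R" "uminus ` L = L"
  shows "mat_eigenvalue (adj_mat (BiCay R L T)) c \<longleftrightarrow>
    (\<exists>k\<in>{1..CARD('a)}. c = of_real (lam \<psi> R L T (2 * k)) \<or> c = of_real (lam \<psi> R L T (2 * k - 1)))"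
proof -
  have char: "\<psi> k \<in> characters" if "k \<in> {1..CARD('a)}" for k
    using assms(1) that by (auto simp: bij_betw_def)
  have real: "char_sum (\<psi> k) R = of_real (Re (char_sum (\<psi> k) R))"
    "char_sum (\<psi> k) L = of_real (Re (char_sum (\<psi> k) L))" if "k \<in> {1..CARD('a)}" for k
    using char_sum_in_Reals [OF char [OF that]] assms(2,3) by simp_all
  let ?D = "adj_mat (BiCay R L T)"
  let ?P = "\<lambda>k. (c - char_sum (\<psi> k) R) * (c - char_sum (\<psi> k) L) =
    char_sum (\<psi> k) T * cnj (char_sum (\<psi> k) T)"
  have "?P k \<longleftrightarrow> c = of_real (lam \<psi> R L T (2 * k)) \<or> c = of_real (lam \<psi> R L T (2 * k - 1))"
    if k: "k \<in> {1..CARD('a)}" for k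
  proof -
    define s where "s = sqrt ((Re (char_sum (\<psi> k) R) - Re (char_sum (\<psi> k) L))\<^sup>2 +
      4 * (cmod (char_sum (\<psi> k) T))\<^sup>2)"
    have "s\<^sup>2 = (Re (char_sum (\<psi> k) R) - Re (char_sum (\<psi> k) L))\<^sup>2 + 4 * (cmod (char_sum (\<psi> k) T))\<^sup>2"
      by (simp add: s_def)
    then have "complex_of_real (s\<^sup>2) = of_real ((Re (char_sum (\<psi> k) R) - Re (char_sum (\<psi> k) L))\<^sup>2 +
        4 * (cmod (char_sum (\<psi> k) T))\<^sup>2)"
      by simp
    then have "(complex_of_real s)\<^sup>2 = (char_sum (\<psi> k) R - char_sum (\<psi> k) L)\<^sup>2 +
        4 * (char_sum (\<psi> k) T * cnj (char_sum (\<psi> k) T))"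
      by (simp only: of_real_power of_real_add of_real_diff of_real_mult real [OF k, symmetric]
          of_real_numeral complex_norm_square [symmetric])
    from quadratic_roots [OF this, of c] show ?thesis
      using k by (simp only: lam_even lam_odd s_def atLeastAtMost_iff of_real_add of_real_diff
          of_real_divide of_real_numeral real [OF k, symmetric])
  qed
  moreover have "mat_eigenvalue ?D c" if k: "k \<in> {1..CARD('a)}" and P: "?P k" for k
  proof -
    have eigen: "mat_eigenvalue ?D c"
      if "(a, b) \<noteq> (0, 0)" "bichar_op (\<psi> k) R L T (a, b) = (c * a, c * b)" for a b
      unfolding mat_eigenvalue_def
    proof (intro exI conjI)
      show "?D *v bichar_vec (\<psi> k) (a, b) = c *s bichar_vec (\<psi> k) (a, b)"
        unfolding adj_mat_BiCay_bichar_vec [OF char [OF k] assms(2,3)] that(2)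
        by (simp add: bichar_vec_def vec_eq_iff split_sum_all)
      have "bichar_vec (\<psi> k) (a, b) $ Inl 0 = a" "bichar_vec (\<psi> k) (a, b) $ Inr 0 = b"
        using character_zero [OF char [OF k]] by (simp_all add: bichar_vec_def)
      then show "bichar_vec (\<psi> k) (a, b) \<noteq> 0"
        using that(1) by auto
    qed
    show ?thesis
    proof (cases "char_sum (\<psi> k) T = 0")
      case True
      then consider "c = char_sum (\<psi> k) R" | "c = char_sum (\<psi> k) L"
        using P by auto
      then show ?thesis
        using True eigen [of 1 0] eigen [of 0 1] by cases (auto simp: hermitian_op_def)
    next
      case False
      then show ?thesis
        using P by (intro eigen [of "char_sum (\<psi> k) T" "c - char_sum (\<psi> k) R"])
          (auto simp: hermitian_op_def algebra_simps)
    qed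
  qed
  moreover have "\<exists>k\<in>{1..CARD('a)}. ?P k" if eigen: "mat_eigenvalue ?D c"
  proof -
    obtain v where v: "v \<noteq> 0" "?D *v v = c *s v"
      using eigen by (auto simp: mat_eigenvalue_def)
    define a where "a k = (\<Sum>g\<in>UNIV. cnj (\<psi> k g) * v $ Inl g)" for k
    define b where "b k = (\<Sum>g\<in>UNIV. cnj (\<psi> k g) * v $ Inr g)" for k
    have pair: "(\<Sum>u\<in>UNIV. bichar_vec (\<lambda>g. cnj (\<psi> k g)) p $ u * v $ u) = fst p * a k + snd p * b k" for k p
      by (simp add: sum_UNIV_Plus bichar_vec_def a_def b_def sum_distrib_left mult_ac)
    \<comment> \<open>The Fourier coefficients of an eigenvector form an eigenvector of the \<open>2 \<times> 2\<close> matrix.\<close>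
    have coeff: "c * (fst p * a k + snd p * b k) =
        fst (bichar_op (\<lambda>g. cnj (\<psi> k g)) R L T p) * a k + snd (bichar_op (\<lambda>g. cnj (\<psi> k g)) R L T p) * b k"
      if k: "k \<in> {1..CARD('a)}" for k p
    proof -
      let ?w = "bichar_vec (\<lambda>g. cnj (\<psi> k g)) p"
      have "c * (fst p * a k + snd p * b k) = (\<Sum>u\<in>UNIV. ?w $ u * (?D *v v) $ u)"
        by (simp add: v(2) pair [symmetric] sum_distrib_left mult_ac)
      also have "\<dots> = (\<Sum>u\<in>UNIV. \<Sum>w\<in>UNIV. ?w $ u * ?D $ u $ w * v $ w)"
        by (simp add: matrix_vector_mult_def sum_distrib_left mult_ac)
      also have "\<dots> = (\<Sum>w\<in>UNIV. \<Sum>u\<in>UNIV. ?w $ u * ?D $ u $ w * v $ w)"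
        by (rule sum.swap)
      also have "\<dots> = (\<Sum>w\<in>UNIV. (?D *v ?w) $ w * v $ w)"
        by (simp add: matrix_vector_mult_def sum_distrib_left adj_mat_commute mult_ac)
      also have "\<dots> = fst (bichar_op (\<lambda>g. cnj (\<psi> k g)) R L T p) * a k +
          snd (bichar_op (\<lambda>g. cnj (\<psi> k g)) R L T p) * b k"
        by (simp only: adj_mat_BiCay_bichar_vec [OF cnj_character [OF char [OF k]] assms(2,3)] pair)
      finally show ?thesis .
    qed
    have inv: "(\<Sum>k=1..CARD('a). \<psi> k g * (\<Sum>h\<in>UNIV. cnj (\<psi> k h) * f h)) = of_nat CARD('a) * f g"
      for f :: "'a \<Rightarrow> complex" and g
    proof -
      have "(\<Sum>k=1..CARD('a). \<psi> k g * (\<Sum>h\<in>UNIV. cnj (\<psi> k h) * f h)) =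
          (\<Sum>h\<in>UNIV. \<Sum>k=1..CARD('a). cnj (\<psi> k h) * \<psi> k g * f h)"
        by (subst sum.swap) (simp add: sum_distrib_left mult_ac)
      also have "\<dots> = (\<Sum>h\<in>UNIV. (if h = g then of_nat CARD('a) else 0) * f h)"
        unfolding sum_distrib_right [symmetric] character_orthogonality_dual [OF assms(1)] ..
      finally show ?thesis
        by (simp add: if_distrib [of "\<lambda>z. z * _"] cong: if_cong)
    qed
    have "\<exists>k\<in>{1..CARD('a)}. a k \<noteq> 0 \<or> b k \<noteq> 0"
    proof (rule ccontr)
      assume "\<not> ?thesis"
      then have zero: "a k = 0" "b k = 0" if "k \<in> {1..CARD('a)}" for k
        using that by auto
      have "of_nat CARD('a) * v $ Inl g = 0" "of_nat CARD('a) * v $ Inr g = 0" for g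
        unfolding inv [of _ "\<lambda>g. v $ Inl g", symmetric] inv [of _ "\<lambda>g. v $ Inr g", symmetric]
          a_def [symmetric] b_def [symmetric]
        by (simp_all add: zero)
      then have "v = 0"
        by (simp add: vec_eq_iff split_sum_all)
      with v(1) show False ..
    qed
    then obtain k where k: "k \<in> {1..CARD('a)}" and nz: "a k \<noteq> 0 \<or> b k \<noteq> 0"
      by blast
    have cs: "char_sum (\<lambda>g. cnj (\<psi> k g)) S = cnj (char_sum (\<psi> k) S)" for S
      by (simp add: char_sum_def)
    have cr: "cnj (char_sum (\<psi> k) R) = char_sum (\<psi> k) R" "cnj (char_sum (\<psi> k) L) = char_sum (\<psi> k) L"
      using char_sum_in_Reals [OF char [OF k]] assms(2,3) by (simp_all add: Reals_cnj_iff)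
    have eqs: "(c - char_sum (\<psi> k) R) * a k = char_sum (\<psi> k) T * b k"
      "(c - char_sum (\<psi> k) L) * b k = cnj (char_sum (\<psi> k) T) * a k"
      using coeff [OF k, of "(1, 0)"] coeff [OF k, of "(0, 1)"]
      by (simp_all add: hermitian_op_def cs cr algebra_simps)
    have "((c - char_sum (\<psi> k) R) * (c - char_sum (\<psi> k) L) - char_sum (\<psi> k) T * cnj (char_sum (\<psi> k) T)) * a k = 0"
      "((c - char_sum (\<psi> k) R) * (c - char_sum (\<psi> k) L) - char_sum (\<psi> k) T * cnj (char_sum (\<psi> k) T)) * b k = 0"
      using eqs by algebra+
    then have "?P k"
      using nz by auto
    with k show ?thesis by blast
  qed
  ultimately show ?thesis by blast
qed

lemma integral_graph_BiCay:
  fixes \<psi> :: "nat \<Rightarrow> 'a::{finite, ab_group_add} \<Rightarrow> complex" and R L T :: "'a set"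
  assumes "bij_betw \<psi> {1..CARD('a)} characters" "uminus ` R = R" "uminus ` L = L"
  shows "integral_graph (BiCay R L T) \<longleftrightarrow>
    (\<forall>k\<in>{1..CARD('a)}. lam \<psi> R L T (2 * k) \<in> \<int> \<and> lam \<psi> R L T (2 * k - 1) \<in> \<int>)"
proof -
  have "integral_graph (BiCay R L T) \<longleftrightarrow>
      (\<forall>k\<in>{1..CARD('a)}. complex_of_real (lam \<psi> R L T (2 * k)) \<in> \<int> \<and>
        complex_of_real (lam \<psi> R L T (2 * k - 1)) \<in> \<int>)"
    unfolding integral_graph_def mat_eigenvalue_BiCay [OF assms] by blast
  then show ?thesis
    by (simp only: of_real_in_Ints_iff)
qed

lemma lam_pair_eq_of_char_sum_eq_0:
  assumes "k \<ge> 1" "char_sum (\<psi> k) T = 0"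
  shows "{lam \<psi> R L T (2 * k), lam \<psi> R L T (2 * k - 1)} = {Re (char_sum (\<psi> k) R), Re (char_sum (\<psi> k) L)}"
proof (cases "Re (char_sum (\<psi> k) L) \<le> Re (char_sum (\<psi> k) R)")
  case True
  then have "lam \<psi> R L T (2 * k) = Re (char_sum (\<psi> k) R)" "lam \<psi> R L T (2 * k - 1) = Re (char_sum (\<psi> k) L)"
    unfolding lam_even lam_odd [OF assms(1)] assms(2) by simp_all
  then show ?thesis by simp
next
  case False
  then have "lam \<psi> R L T (2 * k) = Re (char_sum (\<psi> k) L)" "lam \<psi> R L T (2 * k - 1) = Re (char_sum (\<psi> k) R)"
    unfolding lam_even lam_odd [OF assms(1)] assms(2) by simp_all
  then show ?thesis by (simp add: insert_commute)
qed

lemma lam_add: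
  assumes "k \<ge> 1"
  shows "lam \<psi> R L T (2 * k) + lam \<psi> R L T (2 * k - 1) = Re (char_sum (\<psi> k) R) + Re (char_sum (\<psi> k) L)"
proof -
  have "(a + s) / 2 + (a - s) / 2 = a" for a s :: real
    by (simp add: field_simps)
  then show ?thesis
    unfolding lam_even lam_odd [OF assms] .
qed

lemma eigenvalue_support_Un:
  fixes \<psi> :: "nat \<Rightarrow> 'a::finite \<Rightarrow> complex"
  shows "eigenvalue_support \<psi> R L T R \<union> eigenvalue_support \<psi> R L T L =
    (\<Union>k\<in>{1..CARD('a)}. {lam \<psi> R L T (2 * k), lam \<psi> R L T (2 * k - 1)})"
  unfolding eigenvalue_support_def UN_Un_distrib [symmetric]
proof (intro SUP_cong refl)
  fix k assume "k \<in> {1..CARD('a)}"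
  then show "(if k \<in> Hset \<psi> T then {Re (char_sum (\<psi> k) R)} else {lam \<psi> R L T (2 * k), lam \<psi> R L T (2 * k - 1)}) \<union>
      (if k \<in> Hset \<psi> T then {Re (char_sum (\<psi> k) L)} else {lam \<psi> R L T (2 * k), lam \<psi> R L T (2 * k - 1)}) =
      {lam \<psi> R L T (2 * k), lam \<psi> R L T (2 * k - 1)}"
    using lam_pair_eq_of_char_sum_eq_0 [of k \<psi> T R L] by (cases "k \<in> Hset \<psi> T") (auto simp: Hset_def)
qed

lemma differences_iff_base_point:
  assumes "c \<in> S"
  shows "(\<forall>x\<in>S. \<forall>y\<in>S. t * (x - y) \<in> two_pi_Ints) \<longleftrightarrow> (\<forall>x\<in>S. t * (c - x) \<in> two_pi_Ints)"
proof (intro iffI)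
  assume "\<forall>x\<in>S. \<forall>y\<in>S. t * (x - y) \<in> two_pi_Ints"
  then show "\<forall>x\<in>S. t * (c - x) \<in> two_pi_Ints"
    using assms by (rule bspec)
next
  assume *: "\<forall>x\<in>S. t * (c - x) \<in> two_pi_Ints"
  have "t * (x - y) \<in> two_pi_Ints" if "x \<in> S" "y \<in> S" for x y
  proof -
    have "t * (x - y) = t * (c - y) - t * (c - x)"
      by (simp add: algebra_simps)
    then show ?thesis
      using two_pi_Ints_diff * that by metis
  qed
  then show "\<forall>x\<in>S. \<forall>y\<in>S. t * (x - y) \<in> two_pi_Ints"
    by blast
qed

lemma Hset_empty: "Hset \<psi> ({} :: 'a::finite set) = {1..CARD('a)}"
  unfolding Hset_def char_sum_def by auto

lemma one_notin_Hset:
  fixes T :: "'a::finite set"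
  assumes "\<psi> 1 = (\<lambda>_. 1)" "T \<noteq> {}"
  shows "1 \<notin> Hset \<psi> T"
  unfolding Hset_def char_sum_def mem_Collect_eq assms(1) using assms(2) by simp

lemma one_in_range: "1 \<in> {1..CARD('a::finite)}"
  by (simp add: Suc_le_eq)

lemma eigenvalue_support_differences_iff:
  fixes \<psi> :: "nat \<Rightarrow> 'a::finite \<Rightarrow> complex"
  assumes one: "\<psi> 1 = (\<lambda>_. 1)" and int: "eigenvalue_support \<psi> R L T X \<subseteq> \<int>"
  shows "t \<noteq> 0 \<and> (\<forall>x\<in>eigenvalue_support \<psi> R L T X. \<forall>y\<in>eigenvalue_support \<psi> R L T X.
      t * (x - y) \<in> two_pi_Ints) \<longleftrightarrow>
    t \<in> (if T = {} then period_times (Mempty \<psi> X)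
          else period_times (gcd (gcd (M0 \<psi> R L T) (M1 \<psi> R L T)) (MX \<psi> R L T X)))"
proof (cases "T = {}")
  case True
  have supp: "eigenvalue_support \<psi> R L T X = (\<lambda>k. Re (char_sum (\<psi> k) X)) ` {1..CARD('a)}"
    by (auto simp: eigenvalue_support_def True Hset_empty)
  have card: "Re (char_sum (\<psi> 1) X) = real (card X)"
    unfolding one char_sum_def by simp
  have mem: "real (card X) \<in> eigenvalue_support \<psi> R L T X"
    unfolding supp card [symmetric] using one_in_range by (rule imageI)
  have sub: "(\<lambda>k. real (card X) - Re (char_sum (\<psi> k) X)) ` {1..CARD('a)} \<subseteq> \<int>"
    using int unfolding supp by auto
  show ?thesis
    unfolding differences_iff_base_point [OF mem] if_P [OF True] Mempty_def period_times_gcd_set [OF sub]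
    unfolding supp by blast
next
  case False
  let ?K = "{1..CARD('a)}" and ?H = "Hset \<psi> T" and ?l = "lam \<psi> R L T"
  have H: "?H \<subseteq> ?K"
    by (auto simp: Hset_def)
  have supp: "eigenvalue_support \<psi> R L T X =
      (\<Union>k\<in>?K - ?H. {?l (2 * k), ?l (2 * k - 1)}) \<union> (\<lambda>k. Re (char_sum (\<psi> k) X)) ` ?H"
    unfolding eigenvalue_support_def using H by (auto split: if_splits simp del: One_nat_def)
  have one_mem: "1 \<in> ?K - ?H"
    using one_in_range one_notin_Hset [of \<psi> T] one False by blast
  then have mem: "?l 2 \<in> eigenvalue_support \<psi> R L T X"
    unfolding supp by (intro UnI1 UN_I [of 1]) simp_all
  have ints: "?l (2 * k) \<in> \<int>" "?l (2 * k - 1) \<in> \<int>" if "k \<in> ?K - ?H" for k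
    using int that unfolding supp by blast+
  have "?l 2 \<in> \<int>"
    using int mem by blast
  have 0: "t \<in> period_times (M0 \<psi> R L T) \<longleftrightarrow>
      t \<noteq> 0 \<and> (\<forall>k\<in>?K - ?H. t * (?l (2 * k) - ?l (2 * k - 1)) \<in> two_pi_Ints)"
    unfolding M0_def by (subst period_times_gcd_set) (use ints in \<open>auto simp del: One_nat_def\<close>)
  have 1: "t \<in> period_times (M1 \<psi> R L T) \<longleftrightarrow>
      t \<noteq> 0 \<and> (\<forall>k\<in>?K - ?H. t * (?l 2 - ?l (2 * k - 1)) \<in> two_pi_Ints)"
    unfolding M1_def by (subst period_times_gcd_set) (use ints \<open>?l 2 \<in> \<int>\<close> in \<open>auto simp del: One_nat_def\<close>)
  have X: "t \<in> period_times (MX \<psi> R L T X) \<longleftrightarrow>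
      t \<noteq> 0 \<and> (\<forall>k\<in>?H. t * (?l 2 - Re (char_sum (\<psi> k) X)) \<in> two_pi_Ints)"
    unfolding MX_def by (subst period_times_gcd_set) (use int supp \<open>?l 2 \<in> \<int>\<close> in auto)
  have "t * (?l 2 - ?l (2 * k)) \<in> two_pi_Ints \<and> t * (?l 2 - ?l (2 * k - 1)) \<in> two_pi_Ints \<longleftrightarrow>
      t * (?l (2 * k) - ?l (2 * k - 1)) \<in> two_pi_Ints \<and> t * (?l 2 - ?l (2 * k - 1)) \<in> two_pi_Ints" for k
    using two_pi_Ints_diff [of "t * (?l 2 - ?l (2 * k - 1))" "t * (?l (2 * k) - ?l (2 * k - 1))"]
      two_pi_Ints_diff [of "t * (?l 2 - ?l (2 * k - 1))" "t * (?l 2 - ?l (2 * k))"]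
    by (auto simp: algebra_simps simp del: One_nat_def)
  then have "(\<forall>x\<in>eigenvalue_support \<psi> R L T X. t * (?l 2 - x) \<in> two_pi_Ints) \<longleftrightarrow>
      (\<forall>k\<in>?K - ?H. t * (?l (2 * k) - ?l (2 * k - 1)) \<in> two_pi_Ints) \<and>
      (\<forall>k\<in>?K - ?H. t * (?l 2 - ?l (2 * k - 1)) \<in> two_pi_Ints) \<and>
      (\<forall>k\<in>?H. t * (?l 2 - Re (char_sum (\<psi> k) X)) \<in> two_pi_Ints)"
    unfolding supp by blast
  then show ?thesis
    unfolding differences_iff_base_point [OF mem] period_times_gcd 0 1 X if_not_P [OF False] by blast
qed

lemma sum_Re_char_sum_eq_0:
  fixes \<psi> :: "nat \<Rightarrow> 'a::{finite, ab_group_add} \<Rightarrow> complex"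
  assumes "bij_betw \<psi> {1..CARD('a)} characters" "0 \<notin> X"
  shows "(\<Sum>k=1..CARD('a). Re (char_sum (\<psi> k) X)) = 0"
proof -
  have char: "\<psi> k \<in> characters" if "k \<in> {1..CARD('a)}" for k
    using assms(1) that by (auto simp: bij_betw_def)
  have "(\<Sum>k=1..CARD('a). char_sum (\<psi> k) X) = (\<Sum>x\<in>X. \<Sum>k=1..CARD('a). \<psi> k x)"
    unfolding char_sum_def by (rule sum.swap)
  also have "\<dots> = (\<Sum>x\<in>X. \<Sum>k=1..CARD('a). cnj (\<psi> k 0) * \<psi> k x)"
    by (intro sum.cong refl) (simp add: character_zero char)
  also have "\<dots> = 0"
    unfolding character_orthogonality_dual [OF assms(1)] using assms(2)
    by (intro sum.neutral) auto
  finally show ?thesis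
    by (metis Re_sum zero_complex.sel(1))
qed

lemma two_pi_Ints_iff: "t * x \<in> two_pi_Ints \<longleftrightarrow> t / (2 * pi) * x \<in> \<int>"
proof -
  have "t * x = 2 * pi * of_int z \<longleftrightarrow> t / (2 * pi) * x = of_int z" for z
    by (simp add: field_simps)
  then show ?thesis
    unfolding two_pi_Ints_def Ints_def image_iff by simp
qed

text \<open>As \<open>a\<close> is the mean of the differences \<open>a - f i\<close>, it is a rational multiple of \<open>2 \<pi> / t\<close>.\<close>

lemma Rats_if_differences_in_two_pi_Ints:
  fixes f :: "'i \<Rightarrow> real"
  assumes "finite I" "I \<noteq> {}" "sum f I = 0"
    and "\<And>i. i \<in> I \<Longrightarrow> t * (a - f i) \<in> two_pi_Ints"
    and "i \<in> I"
  shows "t / (2 * pi) * a \<in> \<rat>" "t / (2 * pi) * f i \<in> \<rat>"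
proof -
  have int: "t / (2 * pi) * (a - f i) \<in> \<int>" if "i \<in> I" for i
    using assms(4) [OF that] by (simp add: two_pi_Ints_iff)
  then have "(\<Sum>i\<in>I. t / (2 * pi) * (a - f i)) \<in> \<int>"
    by (rule Ints_sum)
  also have "(\<Sum>i\<in>I. t / (2 * pi) * (a - f i)) = of_nat (card I) * (t / (2 * pi) * a)"
    unfolding sum_distrib_left [symmetric] sum_subtractf assms(3) by simp
  finally have "of_nat (card I) * (t / (2 * pi) * a) / of_nat (card I) \<in> \<rat>"
    using Ints_subset_Rats by (intro Rats_divide) auto
  then show *: "t / (2 * pi) * a \<in> \<rat>"
    using assms(1,2) by simp
  have "t / (2 * pi) * a - t / (2 * pi) * (a - f i) \<in> \<rat>"
    using int [OF assms(5)] Ints_subset_Rats by (intro Rats_diff *) auto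
  then show "t / (2 * pi) * f i \<in> \<rat>"
    by (simp add: right_diff_distrib)
qed

lemma Rats_mult_cancel:
  fixes c x y :: real
  assumes "c \<noteq> 0" "y \<noteq> 0" "y \<in> \<rat>" "c * y \<in> \<rat>" "c * x \<in> \<rat>"
  shows "x \<in> \<rat>"
proof -
  have "x = (c * x) / (c * y) * y"
    using assms(1,2) by simp
  also have "\<dots> \<in> \<rat>"
    by (rule Rats_mult [OF Rats_divide [OF assms(5,4)] assms(3)])
  finally show ?thesis .
qed

lemma char_sum_in_Rats_if_periodic:
  fixes \<psi> :: "nat \<Rightarrow> 'a::{finite, ab_group_add} \<Rightarrow> complex"
  assumes "bij_betw \<psi> {1..CARD('a)} characters" "0 \<notin> X" "t \<noteq> 0"
    and "\<And>k. k \<in> {1..CARD('a)} \<Longrightarrow> t * (real (card X) - Re (char_sum (\<psi> k) X)) \<in> two_pi_Ints"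
    and "k \<in> {1..CARD('a)}"
  shows "Re (char_sum (\<psi> k) X) \<in> \<rat>"
proof (cases "X = {}")
  case True
  then show ?thesis by (simp add: char_sum_def)
next
  case False
  have "t / (2 * pi) * real (card X) \<in> \<rat>" "t / (2 * pi) * Re (char_sum (\<psi> k) X) \<in> \<rat>"
    using Rats_if_differences_in_two_pi_Ints [of "{1..CARD('a)}" "\<lambda>k. Re (char_sum (\<psi> k) X)" t "real (card X)" k]
      sum_Re_char_sum_eq_0 [OF assms(1,2)] assms(3-5) by auto
  moreover have "t / (2 * pi) \<noteq> 0" "real (card X) \<noteq> 0" "real (card X) \<in> \<rat>"
    using False assms(3) by simp_all
  ultimately show ?thesis
    using Rats_mult_cancel by blast
qed

lemma lam_in_Rats_if_periodic:
  fixes \<psi> :: "nat \<Rightarrow> 'a::{finite, ab_group_add} \<Rightarrow> complex" and R L T :: "'a set"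
  assumes "bij_betw \<psi> {1..CARD('a)} characters" "\<psi> 1 = (\<lambda>_. 1)" "0 \<notin> R \<union> L" "T \<noteq> {}" "t \<noteq> 0"
    and diff: "\<And>k. k \<in> {1..CARD('a)} \<Longrightarrow> t * (lam \<psi> R L T 2 - lam \<psi> R L T (2 * k)) \<in> two_pi_Ints"
      "\<And>k. k \<in> {1..CARD('a)} \<Longrightarrow> t * (lam \<psi> R L T 2 - lam \<psi> R L T (2 * k - 1)) \<in> two_pi_Ints"
    and "k \<in> {1..CARD('a)}"
  shows "lam \<psi> R L T (2 * k) \<in> \<rat>" "lam \<psi> R L T (2 * k - 1) \<in> \<rat>"
proof -
  let ?l = "lam \<psi> R L T"
  define c where "c = t / (2 * pi)"
  define f where "f = (\<lambda>(k, b). if b then ?l (2 * k) else ?l (2 * k - 1))"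
  let ?I = "{1..CARD('a)} \<times> (UNIV :: bool set)"
  have "sum f ?I = (\<Sum>k=1..CARD('a). ?l (2 * k) + ?l (2 * k - 1))"
    unfolding f_def sum.cartesian_product [symmetric]
    by (intro sum.cong refl) (simp add: UNIV_bool)
  also have "\<dots> = (\<Sum>k=1..CARD('a). Re (char_sum (\<psi> k) R) + Re (char_sum (\<psi> k) L))"
    by (intro sum.cong refl) (simp only: lam_add atLeastAtMost_iff)
  also have "\<dots> = 0"
    using sum_Re_char_sum_eq_0 [OF assms(1)] assms(3) by (simp add: sum.distrib)
  finally have sum: "sum f ?I = 0" .
  have d: "t * (?l 2 - f i) \<in> two_pi_Ints" if "i \<in> ?I" for i
    using diff that by (auto simp: f_def simp del: One_nat_def split: prod.split)
  have ne: "?I \<noteq> {}"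
    using assms(8) by blast
  have fi: "c * ?l 2 \<in> \<rat>" "c * f i \<in> \<rat>" if "i \<in> ?I" for i
    unfolding c_def using Rats_if_differences_in_two_pi_Ints [OF _ ne sum d that] by simp_all
  have rat: "c * ?l (2 * k) \<in> \<rat>" "c * ?l (2 * k - 1) \<in> \<rat>" if "k \<in> {1..CARD('a)}" for k
    using fi(2) [of "(k, True)"] fi(2) [of "(k, False)"] that by (auto simp: f_def simp del: One_nat_def)
  have cs: "char_sum (\<psi> 1) X = of_nat (card X)" for X
    unfolding assms(2) char_sum_def by simp
  have l1: "?l 2 = (real (card R) + real (card L) +
      sqrt ((real (card R) - real (card L))\<^sup>2 + 4 * (real (card T))\<^sup>2)) / 2"
    using lam_even [of \<psi> R L T 1] by (simp add: cs del: One_nat_def)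
  have "?l 2 + ?l 1 = real (card R) + real (card L)"
    using lam_add [of 1 \<psi> R L T] cs by simp
  moreover have "c * ?l 2 + c * ?l 1 \<in> \<rat>"
    using rat [OF one_in_range] by (intro Rats_add) simp_all
  ultimately have sum_rat: "c * (real (card R) + real (card L)) \<in> \<rat>"
    by (metis distrib_left)
  obtain y where y: "y \<noteq> 0" "y \<in> \<rat>" "c * y \<in> \<rat>"
  proof (cases "real (card R) + real (card L) = 0")
    case True
    then have "real (card R) = 0" "real (card L) = 0"
      by linarith+
    then have "?l 2 = real (card T)"
      unfolding l1 by (simp add: real_sqrt_mult)
    moreover have "c * ?l 2 \<in> \<rat>"
      using fi(1) ne by blast
    ultimately show ?thesis
      using that [of "real (card T)"] assms(4) by simp
  next
    case False
    then show ?thesis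
      using that [OF False _ sum_rat] by simp
  qed
  have "c \<noteq> 0"
    using assms(5) by (simp add: c_def)
  then show "?l (2 * k) \<in> \<rat>" "?l (2 * k - 1) \<in> \<rat>"
    using Rats_mult_cancel y rat [OF assms(8)] by blast+
qed

lemma integral_graph_if_periodic:
  fixes \<psi> :: "nat \<Rightarrow> 'a::{finite, ab_group_add} \<Rightarrow> complex" and R L T :: "'a set"
  assumes "bij_betw \<psi> {1..CARD('a)} characters" "\<psi> 1 = (\<lambda>_. 1)"
    and "uminus ` R = R" "uminus ` L = L" "0 \<notin> R \<union> L"
    and "periodic (BiCay R L T) t"
  shows "integral_graph (BiCay R L T)"
proof -
  let ?l = "lam \<psi> R L T" and ?S = "eigenvalue_support \<psi> R L T"
  have t: "t \<noteq> 0"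
    using assms(6) by (simp add: periodic_def)
  have "periodic_at (BiCay R L T) (Inl 0) t" "periodic_at (BiCay R L T) (Inr 0) t"
    using assms(6) by (simp_all add: periodic_def periodic_at_def)
  then have diff: "t * (x - y) \<in> two_pi_Ints" if "X \<in> {R, L}" "x \<in> ?S X" "y \<in> ?S X" for X x y
    using periodic_at_BiCay [OF assms(1,3,4)] that by blast
  have "?l (2 * k) \<in> \<rat> \<and> ?l (2 * k - 1) \<in> \<rat>" if k: "k \<in> {1..CARD('a)}" for k
  proof (cases "T = {}")
    case True
    have supp: "Re (char_sum (\<psi> k) X) \<in> ?S X" if "k \<in> {1..CARD('a)}" for k X
      using that by (auto simp: eigenvalue_support_def True Hset_empty)
    have card: "Re (char_sum (\<psi> 1) X) = real (card X)" for X
      unfolding assms(2) char_sum_def by simp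
    have "Re (char_sum (\<psi> k) X) \<in> \<rat>" if X: "X \<in> {R, L}" for X
    proof (rule char_sum_in_Rats_if_periodic [OF assms(1) _ t _ k])
      show "0 \<notin> X"
        using assms(5) X by auto
      show "t * (real (card X) - Re (char_sum (\<psi> k) X)) \<in> two_pi_Ints" if "k \<in> {1..CARD('a)}" for k
        using diff [OF X supp [OF one_in_range] supp [OF that]] by (simp only: card)
    qed
    moreover have "{?l (2 * k), ?l (2 * k - 1)} = {Re (char_sum (\<psi> k) R), Re (char_sum (\<psi> k) L)}"
      using k by (intro lam_pair_eq_of_char_sum_eq_0) (simp_all add: True char_sum_def)
    ultimately show ?thesis
      by (metis doubleton_eq_iff insertCI)
  next
    case False
    have "1 \<in> {1..CARD('a)} - Hset \<psi> T"
      using one_in_range one_notin_Hset [of \<psi> T] assms(2) False by blast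
    then have mem: "?l 2 \<in> ?S X" for X
      unfolding eigenvalue_support_def by (intro UN_I [of 1]) simp_all
    have "t * (?l 2 - x) \<in> two_pi_Ints" if "x \<in> ?S R \<union> ?S L" for x
      using diff mem that by blast
    then have "t * (?l 2 - ?l (2 * k)) \<in> two_pi_Ints" "t * (?l 2 - ?l (2 * k - 1)) \<in> two_pi_Ints"
      if "k \<in> {1..CARD('a)}" for k
      unfolding eigenvalue_support_Un using that by blast+
    then show ?thesis
      using lam_in_Rats_if_periodic [OF assms(1,2,5) False t _ _ k] by blast
  qed
  moreover have "mat_eigenvalue (adj_mat (BiCay R L T)) (of_real (?l (2 * k)))"
    "mat_eigenvalue (adj_mat (BiCay R L T)) (of_real (?l (2 * k - 1)))" if "k \<in> {1..CARD('a)}" for k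
    unfolding mat_eigenvalue_BiCay [OF assms(1,3,4)] using that by blast+
  ultimately have "?l (2 * k) \<in> \<int>" "?l (2 * k - 1) \<in> \<int>" if "k \<in> {1..CARD('a)}" for k
    using that rational_eigenvalue_adj_mat_in_Ints by blast+
  then show ?thesis
    unfolding integral_graph_BiCay [OF assms(1,3,4)] by blast
qed

theorem theorem4p16:
  fixes R L T :: "'a::{finite, ab_group_add} set"
    and \<psi> :: "nat \<Rightarrow> 'a \<Rightarrow> complex"
  assumes "bij_betw \<psi> {1..CARD('a)} characters"
    and "\<psi> 1 = (\<lambda>_. 1)"
    and "uminus ` R = R" and "uminus ` L = L" and "0 \<notin> R \<union> L"
  shows "(integral_graph (BiCay R L T) \<longrightarrow>
            (\<forall>g t.
              (periodic_at (BiCay R L T) (Inl g) t \<longleftrightarrow>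
                 t \<in> (if T = {} then period_times (Mempty \<psi> R)
                      else period_times (gcd (gcd (M0 \<psi> R L T) (M1 \<psi> R L T)) (MX \<psi> R L T R)))) \<and>
              (periodic_at (BiCay R L T) (Inr g) t \<longleftrightarrow>
                 t \<in> (if T = {} then period_times (Mempty \<psi> L)
                      else period_times (gcd (gcd (M0 \<psi> R L T) (M1 \<psi> R L T)) (MX \<psi> R L T L)))))) \<and>
         (\<forall>t. periodic (BiCay R L T) t \<longleftrightarrow>
            integral_graph (BiCay R L T) \<and>
            t \<in> (if T = {} then period_times (gcd (Mempty \<psi> R) (Mempty \<psi> L))
                 else period_times (gcd (gcd (M0 \<psi> R L T) (M1 \<psi> R L T))
                                        (gcd (MX \<psi> R L T R) (MX \<psi> R L T L)))))"
    (is "(?int \<longrightarrow> (\<forall>g t. (_ \<longleftrightarrow> t \<in> ?timesR) \<and> (_ \<longleftrightarrow> t \<in> ?timesL))) \<and>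
         (\<forall>t. _ \<longleftrightarrow> _ \<and> t \<in> ?times)")
proof -
  have at: "periodic_at (BiCay R L T) (Inl g) t \<longleftrightarrow> t \<in> ?timesR"
    "periodic_at (BiCay R L T) (Inr g) t \<longleftrightarrow> t \<in> ?timesL" if ?int for g t
  proof -
    have "eigenvalue_support \<psi> R L T R \<union> eigenvalue_support \<psi> R L T L \<subseteq> \<int>"
      using that unfolding integral_graph_BiCay [OF assms(1,3,4)] eigenvalue_support_Un by blast
    then have "eigenvalue_support \<psi> R L T R \<subseteq> \<int>" "eigenvalue_support \<psi> R L T L \<subseteq> \<int>"
      by simp_all
    then show "periodic_at (BiCay R L T) (Inl g) t \<longleftrightarrow> t \<in> ?timesR"
      "periodic_at (BiCay R L T) (Inr g) t \<longleftrightarrow> t \<in> ?timesL"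
      unfolding periodic_at_BiCay [OF assms(1,3,4)]
      using assms(2) by (simp_all only: eigenvalue_support_differences_iff)
  qed
  have all: "periodic (BiCay R L T) t \<longleftrightarrow> (\<forall>u. periodic_at (BiCay R L T) u t)" for t
    by (auto simp: periodic_def periodic_at_def)
  have times: "t \<in> ?timesR \<and> t \<in> ?timesL \<longleftrightarrow> t \<in> ?times" for t
    by (auto simp: period_times_gcd)
  have periodic: "periodic (BiCay R L T) t \<longleftrightarrow> t \<in> ?times" if ?int for t
    unfolding all split_sum_all at [OF that] times [symmetric] by simp
  have "periodic (BiCay R L T) t \<longleftrightarrow> ?int \<and> t \<in> ?times" for t
    using integral_graph_if_periodic [OF assms, of T t] periodic [of t] by (cases ?int) auto
  with at show ?thesis
    by (intro conjI impI allI) simp_all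
qed

end
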